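(* Let $0<\beta<1$ and let $p=p(N)$ satisfy $p^2N\to\infty$ and $(1-p)Np\to\infty$ as $N\to\infty$. Then, as $N\to\infty$, $$\sqrt{\frac{pN}{1-p}}\left(\frac{Z_N(\beta)}{\mathbb{E} Z_N(\beta)}-1\right)\to \mathcal{N}\left(0,\frac{\beta^2}{4}\right)$$ in distribution.
   Context: Ising model on a directed Erdős–Rényi graph: for each $N\in\mathbb{N}$ let $p=p(N)\in(0,1]$ and let $(\varepsilon_{i,j})_{i,j=1}^N$ be independent Bernoulli random variables (diagonal $i=j$ included, and $\varepsilon_{i,j}$, $\varepsilon_{j,i}$ are independent for $i\ne j$) with $\mathbb{P}(\varepsilon_{i,j}=1)=p=1-\mathbb{P}(\varepsilon_{i,j}=0)$. For $\sigma\in\{-1,+1\}^N$ put $H(\sigma)=-\frac{1}{2Np}\sum_{i,j=1}^N\sigma_i\sigma_j\varepsilon_{i,j}$, and for $\beta>0$ let $Z_N(\beta)=\sum_{\sigma\in\{-1,+1\}^N}\exp(-\beta H(\sigma))$ (a random variable). $\mathbb{E}$ is expectation with respect to the $\varepsilon_{i,j}$. $\mathcal{N}(0,v)$ denotes the centered normal distribution with variance $v$. *)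

theory Defs
  imports "HOL-Probability.Probability"
begin

definition spin_configs :: "nat \<Rightarrow> (nat \<Rightarrow> real) set" where
  "spin_configs N = {1..N} \<rightarrow>\<^sub>E {-1, 1}"

definition hamiltonian :: "nat \<Rightarrow> real \<Rightarrow> (nat \<Rightarrow> nat \<Rightarrow> real) \<Rightarrow> (nat \<Rightarrow> real) \<Rightarrow> real" where
  "hamiltonian N p e \<sigma> =
     - (1 / (2 * real N * p)) * (\<Sum>i=1..N. \<Sum>j=1..N. \<sigma> i * \<sigma> j * e i j)"

definition partition_function :: "nat \<Rightarrow> real \<Rightarrow> real \<Rightarrow> (nat \<Rightarrow> nat \<Rightarrow> real) \<Rightarrow> real" where
  "partition_function N p \<beta> e = (\<Sum>\<sigma>\<in>spin_configs N. exp (- \<beta> * hamiltonian N p e \<sigma>))"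

text \<open>The argument of \<open>centered_normal\<close> is the variance, whereas \<^const>\<open>normal_density\<close>
  takes the standard deviation.\<close>

definition centered_normal :: "real \<Rightarrow> real measure" where
  "centered_normal v = density lborel (\<lambda>x. ennreal (normal_density 0 (sqrt v) x))"

end

theory Submission
  imports Defs "HOL-Real_Asymp.Real_Asymp"
begin

text \<open>Write \<open>\<gamma> = \<beta> / (2Np)\<close>. As \<open>\<epsilon>\<close> takes the values 0 and 1 only, \<open>exp (\<gamma> x \<epsilon>)\<close> is affine in
  \<open>\<epsilon>\<close>, so for \<open>x = \<sigma>\<^sub>i \<sigma>\<^sub>j\<close> it equals its mean times \<open>1 + a\<^sub>x (\<epsilon> - p)\<close>. Hence \<open>Z / E Z\<close> is an average, under a
  Curie--Weiss measure of inverse temperature close to \<open>\<beta> < 1\<close>, of the products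
  \<open>\<Prod>\<^sub>i\<^sub>j (1 + a\<^sub>x (\<epsilon>\<^sub>i\<^sub>j - p))\<close>. The diagonal \<open>i = j\<close>, where always \<open>x = 1\<close>, produces the whole
  fluctuation: the linear statistic \<open>L = a\<^sub>1 \<Sum>\<^sub>i (\<epsilon>\<^sub>i\<^sub>i - p)\<close> satisfies
  \<open>E (Z / E Z - 1 - L)\<^sup>2 = E (Z / E Z)\<^sup>2 - 1 - E L\<^sup>2\<close>, and the right-hand side is
  \<open>o((1 - p) / (Np))\<close> because in the high temperature phase the second moment of the overlap of two
  replicas is \<open>N + O(1)\<close>. The central limit theorem for \<open>L\<close> is read off its
  characteristic function.\<close>

section \<open>Curie--Weiss measures at high temperature\<close>

text \<open>Both \<open>E (Z / E Z)\<^sup>2 - 1\<close> and \<open>E L\<^sup>2\<close> are of order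
  \<open>(1 - p) / (Np)\<close>, so their leading constants have to cancel; a bound
  \<open>O(N)\<close> on the squared overlap would not suffice. Split the slopes on signs as
  \<open>A + B x\<close>, and put \<open>v = p (1 - p)\<close>. The product over all pairs in the
  second moment is at most the exponential of \<open>v N\<^sup>2 A\<^sup>2\<close>, plus
  \<open>v A B\<close> times the two squared magnetizations, plus \<open>v B\<^sup>2\<close> times
  the squared overlap. Only the last term is of leading order, because the first-order parts of the
  slopes at 1 and -1 cancel in \<open>A\<close>, leaving \<open>A = O(\<gamma>\<^sup>2)\<close>.
  Relative to \<open>E L\<^sup>2\<close> the first term is at most of order
  \<open>\<gamma>\<^sup>2 N\<close>, that is \<open>1 / (p\<^sup>2 N)\<close>: this is the role of
  \<open>p\<^sup>2 N \<rightarrow> \<infinity>\<close>. The condition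
  \<open>(1 - p) N p \<rightarrow> \<infinity>\<close> makes the single summands of the rescaled
  \<open>L\<close> uniformly small, as a central limit theorem requires. Replacing the exponential
  by its linear part leaves a quadratic remainder, and it is for this remainder that exponential
  moments of the squared magnetizations and overlap are needed.\<close>

lemma cosh_le_exp_half_square: "cosh x \<le> exp (x\<^sup>2 / 2)" for x :: real
proof -
  have *: "cosh y \<le> exp (y\<^sup>2 / 2)" if "y \<ge> 0" for y :: real
  proof -
    \<comment> \<open>The estimate behind Hoeffding's lemma for a fair sign: with
      \<open>h = 2 y\<close> and weight \<open>1/2\<close> the left side is
      \<open>ln (cosh y)\<close>.\<close>
    have "- (2 * y) * (1/2) + ln (1 + (1/2) * (exp (2 * y) - 1)) \<le> (2 * y)\<^sup>2 / 8"
      using Hoeffdings_lemma_aux[of "2 * y" "1/2"] that by simp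
    moreover have "1 + (1/2) * (exp (2 * y) - 1) = exp y * cosh y"
      by (simp add: cosh_def field_simps flip: exp_add)
    ultimately have "ln (cosh y) \<le> y\<^sup>2 / 2"
      by (simp add: ln_mult power_mult_distrib)
    then show ?thesis
      by (metis cosh_real_pos exp_le_cancel_iff exp_ln)
  qed
  show ?thesis
    using *[of x] *[of "-x"] by (cases "x \<ge> 0") auto
qed

lemma finite_spin_configs [simp]: "finite (spin_configs N)"
  by (simp add: spin_configs_def finite_PiE)

lemma card_spin_configs: "card (spin_configs N) = 2 ^ N"
  by (simp add: spin_configs_def card_PiE numeral_2_eq_2)

lemma spin_cases: "\<sigma> \<in> spin_configs N \<Longrightarrow> i \<in> {1..N} \<Longrightarrow> \<sigma> i = -1 \<or> \<sigma> i = 1"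
  by (auto simp: spin_configs_def PiE_def Pi_def)

lemma spin_mult_cases:
  "\<sigma> \<in> spin_configs N \<Longrightarrow> i \<in> {1..N} \<Longrightarrow> j \<in> {1..N} \<Longrightarrow> \<sigma> i * \<sigma> j = -1 \<or> \<sigma> i * \<sigma> j = 1"
  using spin_cases[of \<sigma> N i] spin_cases[of \<sigma> N j] by auto

lemma spin_square: "\<sigma> \<in> spin_configs N \<Longrightarrow> i \<in> {1..N} \<Longrightarrow> \<sigma> i * \<sigma> i = 1"
  using spin_cases[of \<sigma> N i] by auto

lemma sum_exp_linear_spin:
  "(\<Sum>\<tau>\<in>spin_configs N. exp (c * (\<Sum>i=1..N. s i * \<tau> i))) = (\<Prod>i=1..N. 2 * cosh (c * s i))"
proof -
  have "(\<Prod>i=1..N. 2 * cosh (c * s i)) = (\<Prod>i\<in>{1..N}. \<Sum>t\<in>{-1,1}. exp (c * (s i * t)))"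
    by (intro prod.cong refl) (simp add: cosh_field_def)
  also have "\<dots> = (\<Sum>\<tau>\<in>spin_configs N. \<Prod>i\<in>{1..N}. exp (c * (s i * \<tau> i)))"
    unfolding spin_configs_def by (rule prod_sum_PiE) auto
  also have "\<dots> = (\<Sum>\<tau>\<in>spin_configs N. exp (c * (\<Sum>i=1..N. s i * \<tau> i)))"
    by (simp add: exp_sum sum_distrib_left)
  finally show ?thesis by simp
qed

text \<open>Completing the square: the tilt moves the mean from 0 to \<open>c\<close> and costs
  \<open>exp (c\<^sup>2 / 2)\<close>. Read from right to left, the exponential of a square becomes
  an average of exponentials of linear terms.\<close>

lemma has_integral_std_normal_exp:
  "has_bochner_integral lborel (\<lambda>x. std_normal_density x * exp (c * x)) (exp (c\<^sup>2 / 2))"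
proof -
  have "(\<lambda>x. std_normal_density x * exp (c * x)) = (\<lambda>x. exp (c\<^sup>2 / 2) * normal_density c 1 x)"
    by (auto simp: normal_density_def power2_eq_square field_simps simp flip: exp_add)
  moreover have "has_bochner_integral lborel (\<lambda>x. exp (c\<^sup>2 / 2) * normal_density c 1 x) (exp (c\<^sup>2 / 2) * 1)"
    by (intro has_bochner_integral_mult_right) (simp add: has_bochner_integral_iff)
  ultimately show ?thesis by simp
qed

text \<open>The tilt only changes the variance, from 1 to \<open>1 / (1 - \<rho>)\<close>;
  finiteness for \<open>\<rho> < 1\<close> is the point where high temperature enters.\<close>

lemma has_integral_std_normal_exp_square:
  assumes "\<rho> < 1"
  shows "has_bochner_integral lborel (\<lambda>x. std_normal_density x * exp (\<rho> * x\<^sup>2 / 2)) (1 / sqrt (1 - \<rho>))"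
proof -
  have "(\<lambda>x. std_normal_density x * exp (\<rho> * x\<^sup>2 / 2)) =
      (\<lambda>x. 1 / sqrt (1 - \<rho>) * normal_density 0 (1 / sqrt (1 - \<rho>)) x)"
    using assms
    by (auto simp: normal_density_def power_divide real_sqrt_divide real_sqrt_mult field_simps simp flip: exp_add)
  moreover have "has_bochner_integral lborel
      (\<lambda>x. 1 / sqrt (1 - \<rho>) * normal_density 0 (1 / sqrt (1 - \<rho>)) x) (1 / sqrt (1 - \<rho>) * 1)"
    using assms by (intro has_bochner_integral_mult_right) (simp add: has_bochner_integral_iff)
  ultimately show ?thesis by simp
qed

text \<open>The Gaussian linearisation of the square (Hubbard--Stratonovich).\<close>

lemma sum_exp_square_spin_le:
  assumes "0 \<le> \<rho>" "\<rho> < 1" "N > 0" and s: "\<And>i. i \<in> {1..N} \<Longrightarrow> s i = -1 \<or> s i = 1"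
  shows "(\<Sum>\<tau>\<in>spin_configs N. exp (\<rho> / 2 * ((\<Sum>i=1..N. s i * \<tau> i)\<^sup>2 / N))) \<le> 2 ^ N / sqrt (1 - \<rho>)"
proof -
  \<comment> \<open>Chosen so that \<open>(c S)\<^sup>2 / 2 = \<rho> / 2 * (S\<^sup>2 / N)\<close>;
    the \<open>N\<close> sites then contribute \<open>N c\<^sup>2 = \<rho>\<close>, free of
    \<open>N\<close>.\<close>
  define c where "c = sqrt (\<rho> / N)"
  have c2: "c\<^sup>2 = \<rho> / N" using assms by (simp add: c_def)
  have int: "has_bochner_integral lborel
      (\<lambda>x. \<Sum>\<tau>\<in>spin_configs N. std_normal_density x * exp (c * (\<Sum>i=1..N. s i * \<tau> i) * x))
      (\<Sum>\<tau>\<in>spin_configs N. exp ((c * (\<Sum>i=1..N. s i * \<tau> i))\<^sup>2 / 2))"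
    by (intro has_bochner_integral_sum has_integral_std_normal_exp)
  have eq: "(\<Sum>\<tau>\<in>spin_configs N. exp ((c * (\<Sum>i=1..N. s i * \<tau> i))\<^sup>2 / 2)) =
      (\<Sum>\<tau>\<in>spin_configs N. exp (\<rho> / 2 * ((\<Sum>i=1..N. s i * \<tau> i)\<^sup>2 / N)))"
    by (intro sum.cong refl) (simp add: power_mult_distrib c2)
  have int2: "has_bochner_integral lborel
      (\<lambda>x. 2 ^ N * (std_normal_density x * exp (\<rho> * x\<^sup>2 / 2))) (2 ^ N * (1 / sqrt (1 - \<rho>)))"
    by (intro has_bochner_integral_mult_right has_integral_std_normal_exp_square assms)
  have le: "(\<Sum>\<tau>\<in>spin_configs N. std_normal_density x * exp (c * (\<Sum>i=1..N. s i * \<tau> i) * x))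
      \<le> 2 ^ N * (std_normal_density x * exp (\<rho> * x\<^sup>2 / 2))" for x
  proof -
    have "(\<Sum>\<tau>\<in>spin_configs N. exp (c * (\<Sum>i=1..N. s i * \<tau> i) * x)) =
        (\<Sum>\<tau>\<in>spin_configs N. exp (c * x * (\<Sum>i=1..N. s i * \<tau> i)))"
      by (simp add: ac_simps)
    also have "\<dots> = (\<Prod>i=1..N. 2 * cosh (c * x * s i))"
      by (rule sum_exp_linear_spin)
    \<comment> \<open>\<open>cosh\<close> is even, so the signs \<open>s\<close> drop out and one
      bound serves the magnetization (\<open>s = 1\<close>) and the overlap with any fixed
      configuration.\<close>
    also have "\<dots> = (\<Prod>i=1..N. 2 * cosh (c * x))"
      using s by (intro prod.cong refl) (metis cosh_minus mult.right_neutral mult_minus_right)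
    also have "\<dots> \<le> (\<Prod>i=1..N. 2 * exp ((c * x)\<^sup>2 / 2))"
      by (intro prod_mono) (auto intro: cosh_le_exp_half_square)
    also have "\<dots> = 2 ^ N * exp (\<rho> * x\<^sup>2 / 2)"
      using assms by (simp add: power_mult_distrib c2 flip: exp_of_nat_mult)
    finally have "std_normal_density x * (\<Sum>\<tau>\<in>spin_configs N. exp (c * (\<Sum>i=1..N. s i * \<tau> i) * x))
        \<le> std_normal_density x * (2 ^ N * exp (\<rho> * x\<^sup>2 / 2))"
      by (intro mult_left_mono) auto
    then show ?thesis by (simp add: sum_distrib_left ac_simps)
  qed
  show ?thesis
    using integral_mono[of lborel
        "\<lambda>x. \<Sum>\<tau>\<in>spin_configs N. std_normal_density x * exp (c * (\<Sum>i=1..N. s i * \<tau> i) * x)"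
        "\<lambda>x. 2 ^ N * (std_normal_density x * exp (\<rho> * x\<^sup>2 / 2))"] le int int2
    unfolding has_bochner_integral_iff eq by simp
qed

section \<open>Exponential moments of magnetization and overlap\<close>

definition magnetization :: "nat \<Rightarrow> (nat \<Rightarrow> real) \<Rightarrow> real" where
  "magnetization N \<sigma> = (\<Sum>i=1..N. \<sigma> i)"

definition overlap :: "nat \<Rightarrow> (nat \<Rightarrow> real) \<Rightarrow> (nat \<Rightarrow> real) \<Rightarrow> real" where
  "overlap N \<sigma> \<tau> = (\<Sum>i=1..N. \<sigma> i * \<tau> i)"

text \<open>The coupling carries no factor \<open>1 / (2N)\<close>; in the usual normalisation the
  inverse temperature is \<open>2 N \<kappa>\<close>, hence the later hypotheses
  \<open>2 N \<kappa> \<le> b < 1\<close>.\<close>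

definition curie_weiss :: "nat \<Rightarrow> real \<Rightarrow> (nat \<Rightarrow> real) \<Rightarrow> real" where
  "curie_weiss N \<kappa> \<sigma> = exp (\<kappa> * (magnetization N \<sigma>)\<^sup>2) /
     (\<Sum>\<tau>\<in>spin_configs N. exp (\<kappa> * (magnetization N \<tau>)\<^sup>2))"

lemma spin_configs_nonempty: "spin_configs N \<noteq> {}"
  by (simp add: spin_configs_def PiE_eq_empty_iff)

lemma curie_weiss_nonneg: "0 \<le> curie_weiss N \<kappa> \<sigma>"
  by (simp add: curie_weiss_def sum_nonneg)

lemma sum_curie_weiss: "(\<Sum>\<sigma>\<in>spin_configs N. curie_weiss N \<kappa> \<sigma>) = 1"
proof -
  have "0 < (\<Sum>\<tau>\<in>spin_configs N. exp (\<kappa> * (magnetization N \<tau>)\<^sup>2))"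
    by (intro sum_pos) (auto simp: spin_configs_nonempty)
  then show ?thesis
    unfolding curie_weiss_def by (simp flip: sum_divide_distrib)
qed

text \<open>Each term of the normalising sum is at least 1. Comparison with the uniform weight makes
  the spins independent, at the price of a bounded factor at high temperature.\<close>

lemma curie_weiss_le:
  assumes "0 \<le> \<kappa>"
  shows "curie_weiss N \<kappa> \<sigma> \<le> exp (\<kappa> * (magnetization N \<sigma>)\<^sup>2) / 2 ^ N"
proof -
  have "(\<Sum>\<tau>\<in>spin_configs N. (1::real)) \<le> (\<Sum>\<tau>\<in>spin_configs N. exp (\<kappa> * (magnetization N \<tau>)\<^sup>2))"
    using assms by (intro sum_mono) auto
  then show ?thesis
    unfolding curie_weiss_def by (intro divide_left_mono) (auto simp: card_spin_configs intro!: mult_pos_pos sum_pos spin_configs_nonempty)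
qed

text \<open>Convexity of \<open>exp\<close>, with weight \<open>\<rho>\<close> close to 1 on the magnetizations, decouples the overlap from
  them at an arbitrarily small cost in temperature; Cauchy--Schwarz would halve the range of \<open>\<beta>\<close>.\<close>

lemma overlap_square_moment_exp:
  fixes b :: real
  assumes N: "N > 0" and \<kappa>: "0 \<le> \<kappa>" "2 * real N * \<kappa> \<le> b" "b < 1"
  shows "(\<Sum>\<sigma>\<in>spin_configs N. \<Sum>\<tau>\<in>spin_configs N. curie_weiss N \<kappa> \<sigma> * curie_weiss N \<kappa> \<tau> *
      exp ((1 - b) / 16 * (((magnetization N \<sigma>)\<^sup>2 + (magnetization N \<tau>)\<^sup>2 + (overlap N \<sigma> \<tau>)\<^sup>2) / N)))
    \<le> 8 / (1 - b)"
proof -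
  define h where "h = 1 - b"
  \<comment> \<open>\<open>\<rho>\<close> is both the convexity weight of the magnetizations and the
    inverse temperature of the resulting sums, so \<open>\<rho>\<^sup>2\<close> has to exceed
    \<open>b\<close>. The choice leaves a margin \<open>h / 8\<close>, which pays for the added
    exponent \<open>h / 16\<close> on the magnetizations, while the weight
    \<open>1 - \<rho> = h / 4\<close> pays for the one on the overlap.\<close>
  define \<rho> where "\<rho> = 1 - h / 4"
  have b0: "0 \<le> b" using \<kappa> by (smt (verit) mult_nonneg_nonneg of_nat_0_le_iff)
  have h: "0 < h" "h \<le> 1" using \<kappa> b0 by (auto simp: h_def)
  have \<rho>: "0 \<le> \<rho>" "\<rho> < 1" using h by (auto simp: \<rho>_def)
  have \<rho>2: "\<rho> * \<rho> \<ge> b + h / 8"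
  proof -
    have "\<rho> * \<rho> = 1 - h / 2 + h * h / 16" by (simp add: \<rho>_def field_simps)
    moreover have "h * h \<ge> 0" by simp
    moreover have "b = 1 - h" by (simp add: h_def)
    ultimately show ?thesis using h by linarith
  qed
  define f where "f \<sigma> = exp (\<rho> / 2 * ((magnetization N \<sigma>)\<^sup>2 / N))" for \<sigma>
  define g where "g \<sigma> \<tau> = exp (\<rho> / 2 * ((overlap N \<sigma> \<tau>)\<^sup>2 / N))" for \<sigma> \<tau>
  have f: "(\<Sum>\<sigma>\<in>spin_configs N. f \<sigma>) \<le> 2 ^ N / sqrt (1 - \<rho>)"
    using sum_exp_square_spin_le[OF \<rho> N, of "\<lambda>_. 1"] by (simp add: f_def magnetization_def)
  have f0: "0 \<le> (\<Sum>\<sigma>\<in>spin_configs N. f \<sigma>)" by (intro sum_nonneg) (simp add: f_def)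
  \<comment> \<open>With \<open>\<sigma>\<close> fixed the overlap is a linear form in
    \<open>\<tau>\<close> with coefficients 1 and -1.\<close>
  have g: "(\<Sum>\<tau>\<in>spin_configs N. g \<sigma> \<tau>) \<le> 2 ^ N / sqrt (1 - \<rho>)" if "\<sigma> \<in> spin_configs N" for \<sigma>
    using sum_exp_square_spin_le[OF \<rho> N, of \<sigma>] spin_cases[OF that] by (simp add: g_def overlap_def)
  have pt: "curie_weiss N \<kappa> \<sigma> * curie_weiss N \<kappa> \<tau> *
      exp ((1 - b) / 16 * (((magnetization N \<sigma>)\<^sup>2 + (magnetization N \<tau>)\<^sup>2 + (overlap N \<sigma> \<tau>)\<^sup>2) / N))
      \<le> (f \<sigma> * f \<tau> + g \<sigma> \<tau>) / 4 ^ N" for \<sigma> \<tau>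
  proof -
    define x y z where "x = (magnetization N \<sigma>)\<^sup>2 / N" "y = (magnetization N \<tau>)\<^sup>2 / N"
      "z = (overlap N \<sigma> \<tau>)\<^sup>2 / N"
    have pos: "0 \<le> x" "0 \<le> y" "0 \<le> z" by (auto simp: x_y_z_def)
    have \<kappa>m: "\<kappa> * (magnetization N \<sigma>)\<^sup>2 = \<kappa> * N * x" "\<kappa> * (magnetization N \<tau>)\<^sup>2 = \<kappa> * N * y"
      using N by (auto simp: x_y_z_def)
    have "curie_weiss N \<kappa> \<sigma> * curie_weiss N \<kappa> \<tau> \<le>
        (exp (\<kappa> * N * x) / 2 ^ N) * (exp (\<kappa> * N * y) / 2 ^ N)"
      using curie_weiss_le[OF \<kappa>(1), of N \<sigma>] curie_weiss_le[OF \<kappa>(1), of N \<tau>] \<kappa>m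
      by (intro mult_mono) (auto simp: curie_weiss_nonneg)
    also have "\<dots> = exp (\<kappa> * N * (x + y)) / 4 ^ N"
      by (simp add: exp_add distrib_left flip: power_mult_distrib)
    finally have "curie_weiss N \<kappa> \<sigma> * curie_weiss N \<kappa> \<tau> * exp (h / 16 * (x + y + z))
        \<le> exp (\<kappa> * N * (x + y)) / 4 ^ N * exp (h / 16 * (x + y + z))"
      by (intro mult_right_mono) auto
    also have "\<dots> = exp (\<kappa> * N * (x + y) + h / 16 * (x + y + z)) / 4 ^ N"
      by (simp add: exp_add)
    also have "\<kappa> * N * (x + y) + h / 16 * (x + y + z) \<le>
        \<rho> * (\<rho> / 2 * (x + y)) + (1 - \<rho>) * (\<rho> / 2 * z)"
    proof -
      have "(\<kappa> * N + h / 16) * (x + y) \<le> (\<rho> * \<rho> / 2) * (x + y)"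
        using \<rho>2 \<kappa>(2) pos by (intro mult_right_mono) (auto simp: mult_ac)
      moreover have "h / 16 * z \<le> ((1 - \<rho>) * \<rho> / 2) * z"
      proof (intro mult_right_mono pos)
        have "h * h \<le> h" using h by (simp add: mult_left_le)
        then show "h / 16 \<le> (1 - \<rho>) * \<rho> / 2" using h by (simp add: \<rho>_def field_simps)
      qed
      ultimately show ?thesis by (simp add: algebra_simps add_divide_distrib diff_divide_distrib)
    qed
    also have "exp (\<rho> * (\<rho> / 2 * (x + y)) + (1 - \<rho>) * (\<rho> / 2 * z)) \<le>
        \<rho> * exp (\<rho> / 2 * (x + y)) + (1 - \<rho>) * exp (\<rho> / 2 * z)"
      using convex_onD[OF convex_on_exp[of 1], of "1 - \<rho>" "\<rho> / 2 * (x + y)" "\<rho> / 2 * z"] \<rho> by simp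
    also have "\<dots> \<le> exp (\<rho> / 2 * (x + y)) + exp (\<rho> / 2 * z)"
      using \<rho> by (intro add_mono) (auto intro: mult_left_le_one_le)
    also have "\<dots> = f \<sigma> * f \<tau> + g \<sigma> \<tau>"
      by (simp add: f_def g_def x_y_z_def exp_add distrib_left)
    finally show ?thesis
      by (simp add: h_def x_y_z_def add_divide_distrib divide_right_mono)
  qed
  have "(\<Sum>\<sigma>\<in>spin_configs N. \<Sum>\<tau>\<in>spin_configs N. curie_weiss N \<kappa> \<sigma> * curie_weiss N \<kappa> \<tau> *
      exp ((1 - b) / 16 * (((magnetization N \<sigma>)\<^sup>2 + (magnetization N \<tau>)\<^sup>2 + (overlap N \<sigma> \<tau>)\<^sup>2) / N)))
    \<le> (\<Sum>\<sigma>\<in>spin_configs N. \<Sum>\<tau>\<in>spin_configs N. (f \<sigma> * f \<tau> + g \<sigma> \<tau>) / 4 ^ N)"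
    by (intro sum_mono pt)
  also have "\<dots> = ((\<Sum>\<sigma>\<in>spin_configs N. f \<sigma>) * (\<Sum>\<sigma>\<in>spin_configs N. f \<sigma>) +
      (\<Sum>\<sigma>\<in>spin_configs N. \<Sum>\<tau>\<in>spin_configs N. g \<sigma> \<tau>)) / 4 ^ N"
    by (simp add: sum.distrib sum_product flip: sum_divide_distrib)
  also have "\<dots> \<le> ((2 ^ N / sqrt (1 - \<rho>)) * (2 ^ N / sqrt (1 - \<rho>)) + 2 ^ N * (2 ^ N / sqrt (1 - \<rho>))) / 4 ^ N"
  proof (intro divide_right_mono add_mono mult_mono f f0)
    have "(\<Sum>\<sigma>\<in>spin_configs N. \<Sum>\<tau>\<in>spin_configs N. g \<sigma> \<tau>) \<le> (\<Sum>\<sigma>\<in>spin_configs N. 2 ^ N / sqrt (1 - \<rho>))"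
      by (intro sum_mono g)
    then show "(\<Sum>\<sigma>\<in>spin_configs N. \<Sum>\<tau>\<in>spin_configs N. g \<sigma> \<tau>) \<le> 2 ^ N * (2 ^ N / sqrt (1 - \<rho>))"
      by (simp add: card_spin_configs)
  qed (use \<rho> in auto)
  also have "\<dots> = 1 / (1 - \<rho>) + 1 / sqrt (1 - \<rho>)"
  proof -
    have "(2::real) ^ N * 2 ^ N = 4 ^ N" by (simp flip: power_mult_distrib)
    then show ?thesis using \<rho> by (simp add: add_divide_distrib)
  qed
  also have "\<dots> \<le> 1 / (1 - \<rho>) + 1 / (1 - \<rho>)"
  proof -
    have "1 - \<rho> \<le> sqrt (1 - \<rho>)"
      using \<rho> by (intro real_le_rsqrt) (auto simp: power2_eq_square mult_left_le)
    then show ?thesis using \<rho> by (intro add_left_mono divide_left_mono) auto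
  qed
  also have "\<dots> = 8 / (1 - b)"
    using h by (simp add: \<rho>_def h_def)
  finally show ?thesis .
qed

text \<open>Follows from \<open>t \<le> exp t\<close> and the exponential moment of two replicas,
  the second one being summed out. The constant is \<open>16 * 8\<close>: 16 from the exponent, 8
  from the moment bound.\<close>

lemma curie_weiss_magnetization_square_le:
  fixes b :: real
  assumes N: "N > 0" and \<kappa>: "0 \<le> \<kappa>" "2 * real N * \<kappa> \<le> b" "b < 1"
  shows "(\<Sum>\<sigma>\<in>spin_configs N. curie_weiss N \<kappa> \<sigma> * (magnetization N \<sigma>)\<^sup>2) \<le> 128 / (1 - b)\<^sup>2 * N"
proof -
  let ?C = "curie_weiss N \<kappa>" and ?S = "spin_configs N"
  let ?E = "\<lambda>\<sigma> \<tau>. exp ((1 - b) / 16 * (((magnetization N \<sigma>)\<^sup>2 + (magnetization N \<tau>)\<^sup>2 + (overlap N \<sigma> \<tau>)\<^sup>2) / N))"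
  have pt: "(magnetization N \<sigma>)\<^sup>2 \<le> 16 * N / (1 - b) * ?E \<sigma> \<tau>" for \<sigma> \<tau>
  proof -
    have "(1 - b) / 16 * ((magnetization N \<sigma>)\<^sup>2 / N) \<le>
        (1 - b) / 16 * (((magnetization N \<sigma>)\<^sup>2 + (magnetization N \<tau>)\<^sup>2 + (overlap N \<sigma> \<tau>)\<^sup>2) / N)"
      using N \<kappa> by (intro mult_left_mono divide_right_mono) auto
    also have "\<dots> \<le> ?E \<sigma> \<tau>"
      using exp_ge_add_one_self[of "(1 - b) / 16 * (((magnetization N \<sigma>)\<^sup>2 + (magnetization N \<tau>)\<^sup>2 + (overlap N \<sigma> \<tau>)\<^sup>2) / N)"] by linarith
    finally show ?thesis using N \<kappa> by (simp add: field_simps)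
  qed
  have "(\<Sum>\<sigma>\<in>?S. ?C \<sigma> * (magnetization N \<sigma>)\<^sup>2) = (\<Sum>\<sigma>\<in>?S. \<Sum>\<tau>\<in>?S. ?C \<sigma> * ?C \<tau> * (magnetization N \<sigma>)\<^sup>2)"
    by (simp add: sum_curie_weiss flip: sum_distrib_left sum_distrib_right)
  also have "\<dots> \<le> (\<Sum>\<sigma>\<in>?S. \<Sum>\<tau>\<in>?S. ?C \<sigma> * ?C \<tau> * (16 * N / (1 - b) * ?E \<sigma> \<tau>))"
    by (intro sum_mono mult_left_mono pt mult_nonneg_nonneg curie_weiss_nonneg)
  also have "\<dots> = 16 * N / (1 - b) * (\<Sum>\<sigma>\<in>?S. \<Sum>\<tau>\<in>?S. ?C \<sigma> * ?C \<tau> * ?E \<sigma> \<tau>)"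
    by (simp add: sum_distrib_left ac_simps)
  also have "\<dots> \<le> 16 * N / (1 - b) * (8 / (1 - b))"
    using \<kappa> by (intro mult_left_mono overlap_square_moment_exp assms) auto
  also have "\<dots> = 128 / (1 - b)\<^sup>2 * N"
    by (simp add: power2_eq_square)
  finally show ?thesis .
qed

section \<open>Exchangeability and the squared overlap up to \<open>O(1)\<close>\<close>

lemma sum_spin_configs_permute:
  assumes \<pi>: "\<pi> permutes {1..N}"
  shows "(\<Sum>\<sigma>\<in>spin_configs N. f (\<sigma> \<circ> \<pi>)) = (\<Sum>\<sigma>\<in>spin_configs N. f \<sigma>)"
proof (rule sum.reindex_bij_witness[where j = "\<lambda>\<sigma>. \<sigma> \<circ> \<pi>" and i = "\<lambda>\<sigma>. \<sigma> \<circ> inv \<pi>"])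
  have *: "\<sigma> \<circ> \<theta> \<in> spin_configs N" if "\<sigma> \<in> spin_configs N" "\<theta> permutes {1..N}" for \<sigma> \<theta>
    using that permutes_in_image[OF that(2)] permutes_not_in[OF that(2)]
    by (force simp: spin_configs_def PiE_def Pi_def extensional_def)
  show "\<sigma> \<circ> \<pi> \<in> spin_configs N" "\<sigma> \<circ> inv \<pi> \<in> spin_configs N" if "\<sigma> \<in> spin_configs N" for \<sigma>
    using * that \<pi> permutes_inv by blast+
  show "\<sigma> \<circ> \<pi> \<circ> inv \<pi> = \<sigma>" "\<sigma> \<circ> inv \<pi> \<circ> \<pi> = \<sigma>" for \<sigma> :: "nat \<Rightarrow> real"
    by (simp_all add: comp_assoc permutes_inv_o[OF \<pi>])
qed auto

lemma magnetization_permute: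
  assumes "\<pi> permutes {1..N}"
  shows "magnetization N (\<sigma> \<circ> \<pi>) = magnetization N \<sigma>"
  unfolding magnetization_def using sum.permute[OF assms, of \<sigma>] by simp

lemma curie_weiss_permute:
  "\<pi> permutes {1..N} \<Longrightarrow> curie_weiss N \<kappa> (\<sigma> \<circ> \<pi>) = curie_weiss N \<kappa> \<sigma>"
  by (simp add: curie_weiss_def magnetization_permute)

text \<open>By exchangeability all two-point correlations agree; they are therefore determined by the
  second moment of the magnetization and are of order \<open>1/N\<close>.\<close>

lemma curie_weiss_overlap_square_le:
  fixes b :: real
  assumes N: "N \<ge> 2" and \<kappa>: "0 \<le> \<kappa>" "2 * real N * \<kappa> \<le> b" "b < 1"
  shows "(\<Sum>\<sigma>\<in>spin_configs N. \<Sum>\<tau>\<in>spin_configs N. curie_weiss N \<kappa> \<sigma> * curie_weiss N \<kappa> \<tau> * (overlap N \<sigma> \<tau>)\<^sup>2)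
    \<le> N + 2 * (128 / (1 - b)\<^sup>2)\<^sup>2"
proof -
  let ?C = "curie_weiss N \<kappa>" and ?S = "spin_configs N" and ?m = "magnetization N"
  define K where "K = 128 / (1 - b)\<^sup>2"
  define c where "c i j = (\<Sum>\<sigma>\<in>?S. ?C \<sigma> * (\<sigma> i * \<sigma> j))" for i j
  \<comment> \<open>Row sums of the correlation matrix \<open>c\<close>. Exchangeability makes them
    equal, so \<open>N * d i\<close> is the second moment of the magnetization, and
    \<open>d i\<close> is at most \<open>K\<close>.\<close>
  define d where "d i = (\<Sum>\<sigma>\<in>?S. ?C \<sigma> * (\<sigma> i * ?m \<sigma>))" for i
  have b0: "0 \<le> b" using \<kappa> by (smt (verit) mult_nonneg_nonneg of_nat_0_le_iff)
  have K1: "1 \<le> K"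
  proof -
    have "(1 - b)\<^sup>2 \<le> 1" using b0 \<kappa> by (intro power_le_one) auto
    then show ?thesis using \<kappa> by (simp add: K_def le_divide_eq)
  qed
  have c_diag: "c i i = 1" if "i \<in> {1..N}" for i
    unfolding c_def using that by (simp add: spin_square sum_curie_weiss cong: sum.cong)
  have c_eq: "c i j = c i k" if "i \<in> {1..N}" "j \<in> {1..N}" "k \<in> {1..N}" "j \<noteq> i" "k \<noteq> i" for i j k
  proof -
    have p: "Transposition.transpose j k permutes {1..N}" using that by (simp add: permutes_swap_id)
    have "c i j = (\<Sum>\<sigma>\<in>?S. ?C (\<sigma> \<circ> Transposition.transpose j k) * ((\<sigma> \<circ> Transposition.transpose j k) i * (\<sigma> \<circ> Transposition.transpose j k) j))"
      unfolding c_def by (rule sum_spin_configs_permute[OF p, symmetric])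
    also have "\<dots> = c i k"
      unfolding c_def curie_weiss_permute[OF p] using that by (simp add: Transposition.transpose_def)
    finally show ?thesis .
  qed
  have d_eq: "d i = d k" if "i \<in> {1..N}" "k \<in> {1..N}" for i k
  proof -
    have p: "Transposition.transpose i k permutes {1..N}" using that by (simp add: permutes_swap_id)
    have "d i = (\<Sum>\<sigma>\<in>?S. ?C (\<sigma> \<circ> Transposition.transpose i k) * ((\<sigma> \<circ> Transposition.transpose i k) i * ?m (\<sigma> \<circ> Transposition.transpose i k)))"
      unfolding d_def by (rule sum_spin_configs_permute[OF p, symmetric])
    also have "\<dots> = d k"
      unfolding d_def curie_weiss_permute[OF p] magnetization_permute[OF p] by simp
    finally show ?thesis .
  qed
  have d_sum: "d i = (\<Sum>j=1..N. c i j)" for i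
    unfolding d_def c_def magnetization_def
    by (subst sum.swap) (simp add: sum_distrib_left)
  have Ed: "real N * d i = (\<Sum>\<sigma>\<in>?S. ?C \<sigma> * (?m \<sigma>)\<^sup>2)" if "i \<in> {1..N}" for i
  proof -
    have "real N * d i = (\<Sum>k=1..N. d k)"
      using sum.cong[OF refl d_eq[OF that], of "{1..N}"] by simp
    also have "\<dots> = (\<Sum>\<sigma>\<in>?S. \<Sum>k=1..N. ?C \<sigma> * (\<sigma> k * ?m \<sigma>))"
      unfolding d_def by (rule sum.swap)
    also have "\<dots> = (\<Sum>\<sigma>\<in>?S. ?C \<sigma> * (?m \<sigma>)\<^sup>2)"
      by (simp add: power2_eq_square magnetization_def flip: sum_distrib_left sum_distrib_right)
    finally show ?thesis .
  qed
  have d_bounds: "0 \<le> d i" "d i \<le> K" if "i \<in> {1..N}" for i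
  proof -
    have "0 \<le> real N * d i"
      unfolding Ed[OF that] by (intro sum_nonneg mult_nonneg_nonneg curie_weiss_nonneg) auto
    then show "0 \<le> d i" using N by (simp add: zero_le_mult_iff)
    have "real N * d i \<le> K * N"
      unfolding Ed[OF that] K_def using N by (intro curie_weiss_magnetization_square_le \<kappa>) auto
    then show "d i \<le> K" using N by (simp add: mult.commute)
  qed
  \<comment> \<open>The equal off-diagonal entries of a row share what the diagonal entry 1 leaves
    of a bounded row sum, so each is \<open>O(1/N)\<close>.\<close>
  have c_off: "c i j = (d i - 1) / (real N - 1)" if "i \<in> {1..N}" "j \<in> {1..N}" "j \<noteq> i" for i j
  proof -
    have "d i = c i i + (\<Sum>k\<in>{1..N}-{i}. c i k)"
      unfolding d_sum using that by (intro sum.remove) auto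
    also have "(\<Sum>k\<in>{1..N}-{i}. c i k) = (\<Sum>k\<in>{1..N}-{i}. c i j)"
      using that by (intro sum.cong refl c_eq) auto
    also have "\<dots> = (real N - 1) * c i j"
      using that N by (simp add: of_nat_diff)
    finally show ?thesis using that N by (simp add: c_diag field_simps)
  qed
  have row: "(\<Sum>j=1..N. (c i j)\<^sup>2) \<le> 1 + 2 * K\<^sup>2 / N" if i: "i \<in> {1..N}" for i
  proof -
    have "(\<Sum>j=1..N. (c i j)\<^sup>2) = (c i i)\<^sup>2 + (\<Sum>j\<in>{1..N}-{i}. (c i j)\<^sup>2)"
      using i by (intro sum.remove) auto
    also have "(\<Sum>j\<in>{1..N}-{i}. (c i j)\<^sup>2) = (\<Sum>j\<in>{1..N}-{i}. ((d i - 1) / (real N - 1))\<^sup>2)"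
      using i by (intro sum.cong refl) (auto simp: c_off)
    also have "\<dots> = (d i - 1)\<^sup>2 / (real N - 1)"
      using i N by (simp add: of_nat_diff power2_eq_square)
    also have "\<dots> \<le> K\<^sup>2 / (real N - 1)"
    proof -
      have "\<bar>d i - 1\<bar> \<le> \<bar>K\<bar>" using d_bounds[OF i] K1 by auto
      then have "(d i - 1)\<^sup>2 \<le> K\<^sup>2" by (simp add: abs_le_square_iff)
      then show ?thesis using N by (intro divide_right_mono) auto
    qed
    \<comment> \<open>\<open>N \<ge> 2\<close> gives \<open>N - 1 \<ge> N / 2\<close>; this is the
      factor 2 in the final bound.\<close>
    also have "\<dots> \<le> K\<^sup>2 / (N / 2)"
      using N by (intro divide_left_mono) auto
    finally show ?thesis using c_diag[OF i] by (simp add: mult.commute)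
  qed
  \<comment> \<open>The two replicas are independent, so the moment is the sum of all squared
    correlations: the diagonal yields exactly \<open>N\<close>, and fewer than
    \<open>N\<^sup>2\<close> entries of size \<open>O(1/N)\<close> yield
    \<open>O(1)\<close>.\<close>
  have "(\<Sum>\<sigma>\<in>?S. \<Sum>\<tau>\<in>?S. ?C \<sigma> * ?C \<tau> * (overlap N \<sigma> \<tau>)\<^sup>2) =
      (\<Sum>\<sigma>\<in>?S. \<Sum>\<tau>\<in>?S. \<Sum>i=1..N. \<Sum>j=1..N. (?C \<sigma> * (\<sigma> i * \<sigma> j)) * (?C \<tau> * (\<tau> i * \<tau> j)))"
    by (simp add: overlap_def power2_eq_square sum_product sum_distrib_left ac_simps)
  also have "\<dots> = (\<Sum>i=1..N. \<Sum>j=1..N. \<Sum>\<sigma>\<in>?S. \<Sum>\<tau>\<in>?S. (?C \<sigma> * (\<sigma> i * \<sigma> j)) * (?C \<tau> * (\<tau> i * \<tau> j)))"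
    by (simp only: sum.swap[of _ "{1..N}" ?S])
  also have "\<dots> = (\<Sum>i=1..N. \<Sum>j=1..N. (c i j)\<^sup>2)"
    by (simp add: c_def power2_eq_square sum_product)
  also have "\<dots> \<le> (\<Sum>i=1..N. 1 + 2 * K\<^sup>2 / N)"
    by (intro sum_mono row)
  also have "\<dots> = N + 2 * K\<^sup>2"
    using N by (simp add: field_simps)
  finally show ?thesis by (simp add: K_def)
qed

section \<open>Families of independent Bernoulli variables\<close>

text \<open>The two atoms have total mass 1, so other values can occur on a null set only;
  identities that need values in {0, 1} therefore hold almost everywhere.\<close>

locale bernoulli_family = prob_space M for M :: "'a measure" +
  fixes I :: "'i set" and X :: "'i \<Rightarrow> 'a \<Rightarrow> real" and p :: real
  assumes finite_I: "finite I"
    and indep: "indep_vars (\<lambda>_. borel) X I"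
    and prob_1: "\<And>i. i \<in> I \<Longrightarrow> prob {\<omega> \<in> space M. X i \<omega> = 1} = p"
    and prob_0: "\<And>i. i \<in> I \<Longrightarrow> prob {\<omega> \<in> space M. X i \<omega> = 0} = 1 - p"
begin

lemma measurable_X [measurable]: "i \<in> I \<Longrightarrow> X i \<in> borel_measurable M"
  using indep by (simp add: indep_vars_def)

lemma AE_X:
  assumes "i \<in> I"
  shows "AE \<omega> in M. X i \<omega> = 0 \<or> X i \<omega> = 1"
proof -
  have [measurable]: "X i \<in> borel_measurable M" using assms by simp
  have "prob ({\<omega> \<in> space M. X i \<omega> = 0} \<union> {\<omega> \<in> space M. X i \<omega> = 1}) = 1"
    using prob_0[OF assms] prob_1[OF assms] by (subst finite_measure_Union) auto
  then have "AE \<omega> in M. \<omega> \<in> {\<omega> \<in> space M. X i \<omega> = 0} \<union> {\<omega> \<in> space M. X i \<omega> = 1}"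
    by (subst (asm) prob_eq_1) auto
  then show ?thesis by (rule AE_mp) auto
qed

lemma AE_X_all: "AE \<omega> in M. \<forall>i\<in>I. X i \<omega> = 0 \<or> X i \<omega> = 1"
  using finite_I AE_X by (simp add: AE_finite_all)

lemma has_expectation_comp:
  fixes f :: "real \<Rightarrow> 'b :: {banach, second_countable_topology}"
  assumes i: "i \<in> I" and [measurable]: "f \<in> borel_measurable borel"
  shows "has_bochner_integral M (\<lambda>\<omega>. f (X i \<omega>)) (p *\<^sub>R f 1 + (1 - p) *\<^sub>R f 0)"
proof -
  have [measurable]: "X i \<in> borel_measurable M" using i by simp
  let ?g = "\<lambda>\<omega>. indicator {\<omega> \<in> space M. X i \<omega> = 1} \<omega> *\<^sub>R f 1 + indicator {\<omega> \<in> space M. X i \<omega> = 0} \<omega> *\<^sub>R f 0"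
  have "has_bochner_integral M ?g (measure M {\<omega> \<in> space M. X i \<omega> = 1} *\<^sub>R f 1 + measure M {\<omega> \<in> space M. X i \<omega> = 0} *\<^sub>R f 0)"
    by (intro has_bochner_integral_add has_bochner_integral_indicator) (auto simp: less_top[symmetric])
  moreover have "AE \<omega> in M. f (X i \<omega>) = ?g \<omega>"
    using AE_X[OF i] AE_space by eventually_elim auto
  ultimately show ?thesis
    using prob_0[OF i] prob_1[OF i] by (subst has_bochner_integral_cong_AE[of _ _ ?g]) auto
qed

text \<open>Stated over normed fields to serve real moments as well as complex characteristic
  functions. Moments involving few of the variables fit in by taking the other factors to be
  1.\<close>

lemma has_expectation_prod:
  fixes f :: "'i \<Rightarrow> real \<Rightarrow> 'b :: {real_normed_field, banach, second_countable_topology}"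
  assumes f: "\<And>i. i \<in> I \<Longrightarrow> f i \<in> borel_measurable borel"
  shows "has_bochner_integral M (\<lambda>\<omega>. \<Prod>i\<in>I. f i (X i \<omega>)) (\<Prod>i\<in>I. p *\<^sub>R f i 1 + (1 - p) *\<^sub>R f i 0)"
proof -
  have ind: "indep_vars (\<lambda>_. borel) (\<lambda>i \<omega>. f i (X i \<omega>)) I"
    by (rule indep_vars_compose2[OF indep]) (use f in auto)
  have int: "integrable M (\<lambda>\<omega>. f i (X i \<omega>))" "(\<integral>\<omega>. f i (X i \<omega>) \<partial>M) = p *\<^sub>R f i 1 + (1 - p) *\<^sub>R f i 0"
    if "i \<in> I" for i
    using has_expectation_comp[OF that f[OF that]] by (auto simp: has_bochner_integral_iff)
  show ?thesis
    using indep_vars_lebesgue_integral[OF finite_I ind int(1)] indep_vars_integrable[OF finite_I ind int(1)] int(2)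
    by (simp add: has_bochner_integral_iff cong: prod.cong)
qed

text \<open>Pythagoras. Every product has mean 1 and the same covariance \<open>p (1 - p) a\<close>
  with each centred variable indexed by \<open>D\<close>, whatever \<open>\<sigma>\<close> is,
  because only the factor at that index matters and its slope is \<open>a\<close>. Hence the linear
  statistic is orthogonal to the error, and the cross terms reduce to its variance.\<close>

lemma square_error_expectation:
  fixes g :: "'s \<Rightarrow> real" and \<alpha> :: "'s \<Rightarrow> 'i \<Rightarrow> real" and a :: real
  assumes S: "(\<Sum>\<sigma>\<in>S. g \<sigma>) = 1"
    and D: "D \<subseteq> I" "\<And>\<sigma> i. \<sigma> \<in> S \<Longrightarrow> i \<in> D \<Longrightarrow> \<alpha> \<sigma> i = a"
  shows "has_bochner_integral M
    (\<lambda>\<omega>. ((\<Sum>\<sigma>\<in>S. g \<sigma> * (\<Prod>i\<in>I. 1 + \<alpha> \<sigma> i * (X i \<omega> - p))) - 1 - a * (\<Sum>i\<in>D. X i \<omega> - p))\<^sup>2)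
    ((\<Sum>\<sigma>\<in>S. \<Sum>\<tau>\<in>S. g \<sigma> * g \<tau> * (\<Prod>i\<in>I. 1 + p * (1 - p) * (\<alpha> \<sigma> i * \<alpha> \<tau> i))) - 1 - card D * a\<^sup>2 * (p * (1 - p)))"
proof -
  define U where "U \<sigma> \<omega> = (\<Prod>i\<in>I. 1 + \<alpha> \<sigma> i * (X i \<omega> - p))" for \<sigma> \<omega>
  define Y where "Y i \<omega> = X i \<omega> - p" for i \<omega>
  define v where "v = p * (1 - p)"
  have finD: "finite D" using D finite_I finite_subset by blast
  have U: "has_bochner_integral M (U \<sigma>) 1" for \<sigma>
  proof -
    have "has_bochner_integral M (\<lambda>\<omega>. \<Prod>i\<in>I. 1 + \<alpha> \<sigma> i * (X i \<omega> - p))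
        (\<Prod>i\<in>I. p *\<^sub>R (1 + \<alpha> \<sigma> i * (1 - p)) + (1 - p) *\<^sub>R (1 + \<alpha> \<sigma> i * (0 - p)))"
      by (rule has_expectation_prod) measurable
    moreover have "p *\<^sub>R (1 + \<alpha> \<sigma> i * (1 - p)) + (1 - p) *\<^sub>R (1 + \<alpha> \<sigma> i * (0 - p)) = 1" for i
      by (simp add: algebra_simps)
    ultimately show ?thesis by (simp add: U_def[abs_def])
  qed
  have UU: "has_bochner_integral M (\<lambda>\<omega>. U \<sigma> \<omega> * U \<tau> \<omega>) (\<Prod>i\<in>I. 1 + v * (\<alpha> \<sigma> i * \<alpha> \<tau> i))" for \<sigma> \<tau>
  proof -
    have "has_bochner_integral M (\<lambda>\<omega>. \<Prod>i\<in>I. (1 + \<alpha> \<sigma> i * (X i \<omega> - p)) * (1 + \<alpha> \<tau> i * (X i \<omega> - p)))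
        (\<Prod>i\<in>I. p *\<^sub>R ((1 + \<alpha> \<sigma> i * (1 - p)) * (1 + \<alpha> \<tau> i * (1 - p)))
          + (1 - p) *\<^sub>R ((1 + \<alpha> \<sigma> i * (0 - p)) * (1 + \<alpha> \<tau> i * (0 - p))))"
      by (rule has_expectation_prod) measurable
    moreover have "p *\<^sub>R ((1 + \<alpha> \<sigma> i * (1 - p)) * (1 + \<alpha> \<tau> i * (1 - p)))
          + (1 - p) *\<^sub>R ((1 + \<alpha> \<sigma> i * (0 - p)) * (1 + \<alpha> \<tau> i * (0 - p))) = 1 + v * (\<alpha> \<sigma> i * \<alpha> \<tau> i)" for i
      by (simp add: v_def algebra_simps)
    ultimately show ?thesis by (simp add: U_def[abs_def] prod.distrib)
  qed
  have UY: "has_bochner_integral M (\<lambda>\<omega>. U \<sigma> \<omega> * Y k \<omega>) (v * a)" if "\<sigma> \<in> S" "k \<in> D" for \<sigma> k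
  proof -
    have k: "k \<in> I" using that D by auto
    \<comment> \<open>The single centred variable is written as a product over \<open>I\<close> that
      is 1 away from \<open>k\<close>; at \<open>k\<close> the constant 1 averages out and the slope
      meets the variance.\<close>
    have "has_bochner_integral M (\<lambda>\<omega>. \<Prod>i\<in>I. (1 + \<alpha> \<sigma> i * (X i \<omega> - p)) * (if i = k then X i \<omega> - p else 1))
        (\<Prod>i\<in>I. p *\<^sub>R ((1 + \<alpha> \<sigma> i * (1 - p)) * (if i = k then 1 - p else 1))
          + (1 - p) *\<^sub>R ((1 + \<alpha> \<sigma> i * (0 - p)) * (if i = k then 0 - p else 1)))"
      by (rule has_expectation_prod) measurable
    moreover have "p *\<^sub>R ((1 + \<alpha> \<sigma> i * (1 - p)) * (if i = k then 1 - p else 1))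
          + (1 - p) *\<^sub>R ((1 + \<alpha> \<sigma> i * (0 - p)) * (if i = k then 0 - p else 1)) = (if i = k then v * a else 1)" for i
      using D(2)[OF that] by (simp add: v_def algebra_simps)
    ultimately show ?thesis using k finite_I
      by (simp add: U_def[abs_def] Y_def[abs_def] prod.distrib prod.delta)
  qed
  have Y: "has_bochner_integral M (Y k) 0" if "k \<in> D" for k
    unfolding Y_def using has_expectation_comp[of k "\<lambda>x. x - p"] that D by (auto simp: algebra_simps)
  have YY: "has_bochner_integral M (\<lambda>\<omega>. Y k \<omega> * Y l \<omega>) (if k = l then v else 0)" if "k \<in> D" "l \<in> D" for k l
  proof -
    have kl: "k \<in> I" "l \<in> I" using that D by auto
    have "has_bochner_integral M (\<lambda>\<omega>. \<Prod>i\<in>I. (if i = k then X i \<omega> - p else 1) * (if i = l then X i \<omega> - p else 1))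
        (\<Prod>i\<in>I. p *\<^sub>R ((if i = k then 1 - p else 1) * (if i = l then 1 - p else 1))
          + (1 - p) *\<^sub>R ((if i = k then 0 - p else 1) * (if i = l then 0 - p else 1)))"
      by (rule has_expectation_prod) measurable
    moreover have "p *\<^sub>R ((if i = k then 1 - p else 1) * (if i = l then 1 - p else 1))
          + (1 - p) *\<^sub>R ((if i = k then 0 - p else 1) * (if i = l then 0 - p else 1)) =
        (if i = k then (if k = l then v else 0) else if i = l then 0 else 1)" for i
      by (auto simp: v_def algebra_simps)
    moreover have "(\<Prod>i\<in>I. if i = k then (if k = l then v else 0) else if i = l then 0 else 1) = (if k = l then v else 0)"
      using kl finite_I by (auto simp: prod.delta prod_zero_iff split: if_splits cong: if_cong)
    ultimately show ?thesis using kl finite_I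
      by (simp add: Y_def[abs_def] prod.distrib prod.delta)
  qed
  have expand: "((\<Sum>\<sigma>\<in>S. g \<sigma> * U \<sigma> \<omega>) - 1 - a * (\<Sum>i\<in>D. Y i \<omega>))\<^sup>2 =
      (\<Sum>\<sigma>\<in>S. \<Sum>\<tau>\<in>S. g \<sigma> * g \<tau> * (U \<sigma> \<omega> * U \<tau> \<omega>)) - 2 * (\<Sum>\<sigma>\<in>S. g \<sigma> * U \<sigma> \<omega>)
      - 2 * a * (\<Sum>\<sigma>\<in>S. \<Sum>i\<in>D. g \<sigma> * (U \<sigma> \<omega> * Y i \<omega>)) + 1 + 2 * a * (\<Sum>i\<in>D. Y i \<omega>)
      + a\<^sup>2 * (\<Sum>i\<in>D. \<Sum>j\<in>D. Y i \<omega> * Y j \<omega>)" for \<omega>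
  proof -
    define R L where "R = (\<Sum>\<sigma>\<in>S. g \<sigma> * U \<sigma> \<omega>)" "L = (\<Sum>i\<in>D. Y i \<omega>)"
    have "(\<Sum>\<sigma>\<in>S. \<Sum>\<tau>\<in>S. g \<sigma> * g \<tau> * (U \<sigma> \<omega> * U \<tau> \<omega>)) = R * R"
      "(\<Sum>\<sigma>\<in>S. \<Sum>i\<in>D. g \<sigma> * (U \<sigma> \<omega> * Y i \<omega>)) = R * L"
      "(\<Sum>i\<in>D. \<Sum>j\<in>D. Y i \<omega> * Y j \<omega>) = L * L"
      by (simp_all add: R_L_def sum_product mult.assoc mult.left_commute[of "U _ _" "g _"])
    then show ?thesis
      unfolding R_L_def[symmetric] by (simp add: power2_eq_square algebra_simps)
  qed
  have "has_bochner_integral M (\<lambda>\<omega>. ((\<Sum>\<sigma>\<in>S. g \<sigma> * U \<sigma> \<omega>) - 1 - a * (\<Sum>i\<in>D. Y i \<omega>))\<^sup>2)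
     ((\<Sum>\<sigma>\<in>S. \<Sum>\<tau>\<in>S. g \<sigma> * g \<tau> * (\<Prod>i\<in>I. 1 + v * (\<alpha> \<sigma> i * \<alpha> \<tau> i))) - 2 * (\<Sum>\<sigma>\<in>S. g \<sigma> * 1)
      - 2 * a * (\<Sum>\<sigma>\<in>S. \<Sum>i\<in>D. g \<sigma> * (v * a)) + 1 + 2 * a * (\<Sum>i\<in>D. 0)
      + a\<^sup>2 * (\<Sum>i\<in>D. \<Sum>j\<in>D. if i = j then v else 0))"
    unfolding expand
    by (intro has_bochner_integral_add has_bochner_integral_diff has_bochner_integral_mult_right
        has_bochner_integral_sum U UU UY Y YY) (auto simp: has_bochner_integral_iff prob_space)
  moreover have "(\<Sum>\<sigma>\<in>S. \<Sum>i\<in>D. g \<sigma> * (v * a)) = card D * (v * a)"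
    using S by (simp flip: sum_distrib_left sum_distrib_right)
  moreover have "(\<Sum>i\<in>D. \<Sum>j\<in>D. if i = j then v else 0) = card D * v"
    using finD by simp
  moreover have "x - 2 * 1 - 2 * a * (card D * (v * a)) + 1 + 2 * a * 0 + a\<^sup>2 * (card D * v) =
      x - 1 - card D * a\<^sup>2 * v" for x
    by (simp add: power2_eq_square)
  moreover have "U \<sigma> \<omega> = (\<Prod>i\<in>I. 1 + \<alpha> \<sigma> i * Y i \<omega>)" for \<sigma> \<omega>
    by (simp add: U_def Y_def)
  ultimately show ?thesis
    unfolding Y_def[symmetric] v_def[symmetric]
    by (simp only: S mult_1_right sum.neutral_const)
qed

end

section \<open>The second moment of the partition function\<close>

definition edge_mean :: "real \<Rightarrow> real \<Rightarrow> real \<Rightarrow> real" where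
  "edge_mean p \<gamma> x = 1 + p * (exp (\<gamma> * x) - 1)"

definition edge_slope :: "real \<Rightarrow> real \<Rightarrow> real \<Rightarrow> real" where
  "edge_slope p \<gamma> x = (exp (\<gamma> * x) - 1) / edge_mean p \<gamma> x"

text \<open>The odd part in \<open>x\<close> of \<open>ln (edge_mean p \<gamma> x)\<close> on signs,
  hence the coefficient of \<open>\<sigma> i * \<sigma> j\<close> in the exponent of the averaged
  weight.\<close>

definition edge_coupling :: "real \<Rightarrow> real \<Rightarrow> real" where
  "edge_coupling p \<gamma> = (ln (edge_mean p \<gamma> 1) - ln (edge_mean p \<gamma> (-1))) / 2"

lemma edge_mean_ge:
  assumes "0 \<le> p" "p \<le> 1" "0 \<le> \<gamma>"
  shows "1 \<le> edge_mean p \<gamma> 1" "exp (- \<gamma>) \<le> edge_mean p \<gamma> (-1)"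
proof -
  show "1 \<le> edge_mean p \<gamma> 1" using assms by (simp add: edge_mean_def)
  have "0 \<le> (1 - p) * (1 - exp (- \<gamma>))" using assms by (intro mult_nonneg_nonneg) auto
  then show "exp (- \<gamma>) \<le> edge_mean p \<gamma> (-1)" by (simp add: edge_mean_def algebra_simps)
qed

lemma edge_mean_pos:
  assumes "0 \<le> p" "p \<le> 1"
  shows "0 < edge_mean p \<gamma> x"
proof -
  have "edge_mean p \<gamma> x = (1 - p) + p * exp (\<gamma> * x)" by (simp add: edge_mean_def algebra_simps)
  also have "\<dots> > 0"
    using assms by (cases "p = 0") (auto intro!: add_nonneg_pos)
  finally show ?thesis .
qed

lemma edge_coupling_nonneg:
  assumes "0 \<le> p" "p \<le> 1" "0 \<le> \<gamma>"
  shows "0 \<le> edge_coupling p \<gamma>"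
proof -
  have "edge_mean p \<gamma> (-1) \<le> 1" using assms by (auto simp: edge_mean_def mult_nonneg_nonpos)
  then show ?thesis
    using edge_mean_ge[OF assms] edge_mean_pos[OF assms(1,2), of \<gamma> "-1"] by (auto simp: edge_coupling_def)
qed

text \<open>From \<open>ln x \<le> x - 1\<close>. For small \<open>\<gamma>\<close> the right side
  is asymptotically \<open>2 p \<gamma>\<close>, and \<open>2 N p \<gamma> = \<beta>\<close>, so the
  inverse temperature of the averaged model is asymptotically at most
  \<open>\<beta>\<close>.\<close>

lemma edge_coupling_le:
  assumes "0 \<le> p" "p \<le> 1" "0 \<le> \<gamma>"
  shows "2 * edge_coupling p \<gamma> \<le> p * (exp \<gamma> - exp (- \<gamma>)) * exp \<gamma>"
proof -
  let ?m = "edge_mean p \<gamma> (-1)"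
  have pos: "0 < edge_mean p \<gamma> 1" "0 < ?m" using edge_mean_pos assms by auto
  have "2 * edge_coupling p \<gamma> = ln (edge_mean p \<gamma> 1 / ?m)"
    using pos by (simp add: edge_coupling_def ln_div)
  also have "\<dots> \<le> edge_mean p \<gamma> 1 / ?m - 1"
    using pos by (intro ln_le_minus_one) auto
  also have "\<dots> = p * (exp \<gamma> - exp (- \<gamma>)) * (1 / ?m)"
    using pos by (simp add: edge_mean_def field_simps)
  also have "\<dots> \<le> p * (exp \<gamma> - exp (- \<gamma>)) * exp \<gamma>"
  proof (intro mult_left_mono mult_nonneg_nonneg)
    have "1 / ?m \<le> 1 / exp (- \<gamma>)"
      using edge_mean_ge[OF assms] pos by (intro divide_left_mono) auto
    then show "1 / ?m \<le> exp \<gamma>" by (simp add: exp_minus field_simps)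
  qed (use assms in auto)
  finally show ?thesis .
qed

section \<open>From averaged edge weights to Curie--Weiss weights\<close>

lemma sum_pairs_spin:
  "(\<Sum>(i, j)\<in>{1..N} \<times> {1..N}. \<sigma> i * \<sigma> j) = (magnetization N \<sigma>)\<^sup>2"
  "(\<Sum>(i, j)\<in>{1..N} \<times> {1..N}. (\<sigma> i * \<sigma> j) * (\<tau> i * \<tau> j)) = (overlap N \<sigma> \<tau>)\<^sup>2"
  by (simp_all add: magnetization_def overlap_def power2_eq_square sum_product sum.cartesian_product ac_simps)

text \<open>Any function on {-1, 1} is affine, so \<open>ln (edge_mean p \<gamma> x) = k +
  edge_coupling p \<gamma> * x\<close> there; the even part \<open>k\<close> gives a factor common
  to all configurations, which cancels.\<close>

lemma edge_mean_normalized_eq_curie_weiss: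
  assumes p: "0 \<le> p" "p \<le> 1" and \<sigma>: "\<sigma> \<in> spin_configs N"
  shows "(\<Prod>(i, j)\<in>{1..N} \<times> {1..N}. edge_mean p \<gamma> (\<sigma> i * \<sigma> j)) /
      (\<Sum>\<tau>\<in>spin_configs N. \<Prod>(i, j)\<in>{1..N} \<times> {1..N}. edge_mean p \<gamma> (\<tau> i * \<tau> j)) =
    curie_weiss N (edge_coupling p \<gamma>) \<sigma>"
proof -
  define k where "k = (ln (edge_mean p \<gamma> 1) + ln (edge_mean p \<gamma> (-1))) / 2"
  define C where "C = exp (k * real (card ({1..N} \<times> {1..N})))"
  have eq: "(\<Prod>(i, j)\<in>{1..N} \<times> {1..N}. edge_mean p \<gamma> (\<tau> i * \<tau> j)) =
      C * exp (edge_coupling p \<gamma> * (magnetization N \<tau>)\<^sup>2)"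
    if \<tau>: "\<tau> \<in> spin_configs N" for \<tau>
  proof -
    have "edge_mean p \<gamma> (\<tau> i * \<tau> j) = exp (k + edge_coupling p \<gamma> * (\<tau> i * \<tau> j))"
      if "i \<in> {1..N}" "j \<in> {1..N}" for i j
    proof -
      have "k + edge_coupling p \<gamma> = ln (edge_mean p \<gamma> 1)" "k - edge_coupling p \<gamma> = ln (edge_mean p \<gamma> (-1))"
        by (simp_all add: k_def edge_coupling_def field_simps)
      then show ?thesis
        using spin_mult_cases[OF \<tau> that] edge_mean_pos[OF p, of \<gamma>] by auto
    qed
    then have "(\<Prod>(i, j)\<in>{1..N} \<times> {1..N}. edge_mean p \<gamma> (\<tau> i * \<tau> j)) =
        (\<Prod>ij\<in>{1..N} \<times> {1..N}. exp (k + edge_coupling p \<gamma> * (\<tau> (fst ij) * \<tau> (snd ij))))"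
      by (intro prod.cong) auto
    also have "\<dots> = exp (\<Sum>ij\<in>{1..N} \<times> {1..N}. k + edge_coupling p \<gamma> * (\<tau> (fst ij) * \<tau> (snd ij)))"
      by (simp add: exp_sum)
    also have "(\<Sum>ij\<in>{1..N} \<times> {1..N}. k + edge_coupling p \<gamma> * (\<tau> (fst ij) * \<tau> (snd ij))) =
        k * real (card ({1..N} \<times> {1..N})) + edge_coupling p \<gamma> * (magnetization N \<tau>)\<^sup>2"
      unfolding sum_pairs_spin[symmetric]
      by (simp add: sum.distrib case_prod_beta sum_distrib_left)
    finally show ?thesis by (simp add: C_def exp_add)
  qed
  have "(\<Sum>\<tau>\<in>spin_configs N. \<Prod>(i, j)\<in>{1..N} \<times> {1..N}. edge_mean p \<gamma> (\<tau> i * \<tau> j)) =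
      C * (\<Sum>\<tau>\<in>spin_configs N. exp (edge_coupling p \<gamma> * (magnetization N \<tau>)\<^sup>2))"
    unfolding sum_distrib_left by (intro sum.cong refl eq)
  then show ?thesis
    unfolding eq[OF \<sigma>] curie_weiss_def by (simp add: C_def)
qed

text \<open>\<open>A\<close> and \<open>B\<close> are the even and odd parts of the slope on signs.
  The point is that \<open>A\<close> is quadratic in \<open>\<gamma>\<close>, whereas
  \<open>B\<close> and the slope at 1 are linear.\<close>

lemma edge_slope_bounds:
  fixes p \<gamma> :: real
  defines "A \<equiv> (edge_slope p \<gamma> 1 + edge_slope p \<gamma> (-1)) / 2"
    and "B \<equiv> (edge_slope p \<gamma> 1 - edge_slope p \<gamma> (-1)) / 2"
  assumes p: "0 \<le> p" "p \<le> 1" and \<gamma>: "0 \<le> \<gamma>" "\<gamma> \<le> 1"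
  shows "\<bar>A\<bar> \<le> 2 * \<gamma>\<^sup>2" "0 \<le> B" "B \<le> 2 * \<gamma>" "0 \<le> edge_slope p \<gamma> 1" "edge_slope p \<gamma> 1 \<le> 2 * \<gamma>"
proof -
  define u w where "u = exp \<gamma> - 1" "w = 1 - exp (- \<gamma>)"
  have u: "0 \<le> u" "u \<le> 2 * \<gamma>"
    using \<gamma> exp_bound[of \<gamma>] mult_left_mono[of \<gamma> 1 \<gamma>] by (auto simp: u_w_def power2_eq_square)
  have w: "0 \<le> w" using \<gamma> by (simp add: u_w_def)
  \<comment> \<open>That is, \<open>(1 + u) * (1 - w) = 1\<close>. This identity turns the
    difference of the two first-order terms in \<open>A\<close> into a product.\<close>
  have uw: "u * w = u - w" by (simp add: u_w_def algebra_simps flip: exp_add)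
  have m1: "edge_mean p \<gamma> 1 = 1 + p * u" and m2: "edge_mean p \<gamma> (-1) = 1 - p * w"
    by (simp_all add: edge_mean_def u_w_def algebra_simps)
  have pos: "1 \<le> 1 + p * u" "0 < 1 - p * w"
    using edge_mean_ge[OF p \<gamma>(1)] edge_mean_pos[OF p] m1 m2 by metis+
  have s1: "edge_slope p \<gamma> 1 = u / (1 + p * u)" and s2: "edge_slope p \<gamma> (-1) = - (w / (1 - p * w))"
    by (simp_all add: edge_slope_def m1 m2 u_w_def minus_divide_left)
  have le1: "u / (1 + p * u) \<le> u" using pos u by (simp add: divide_le_eq mult_left_le mult_le_cancel_left1)
  \<comment> \<open>The left side increases with \<open>p\<close>, and for \<open>p = 1\<close>
    equality holds.\<close>
  have le2: "w / (1 - p * w) \<le> u"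
  proof -
    have "p * (u * w) \<le> u * w" using p u w by (intro mult_left_le_one_le) auto
    moreover have "u * (1 - p * w) = u - p * (u * w)" by (simp add: algebra_simps)
    ultimately have "w \<le> u * (1 - p * w)" using uw by linarith
    then show ?thesis using pos by (simp add: divide_le_eq)
  qed
  have ge1: "0 \<le> u / (1 + p * u)" and ge2: "0 \<le> w / (1 - p * w)" using u w pos by auto
  show "0 \<le> B" "B \<le> 2 * \<gamma>" "0 \<le> edge_slope p \<gamma> 1" "edge_slope p \<gamma> 1 \<le> 2 * \<gamma>"
    using le1 le2 ge1 ge2 u by (simp_all add: B_def s1 s2)
  have "2 * A = (1 - 2 * p) * (u / (1 + p * u)) * (w / (1 - p * w))"
  proof -
    have "2 * A = (u * (1 - p * w) - w * (1 + p * u)) / ((1 + p * u) * (1 - p * w))"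
    proof -
      have "2 * A = u / (1 + p * u) - w / (1 - p * w)" unfolding A_def s1 s2 by (simp add: mult.commute)
      then show ?thesis using pos by (simp add: diff_frac_eq)
    qed
    also have "u * (1 - p * w) - w * (1 + p * u) = (1 - 2 * p) * (u * w)"
      using uw by (simp add: algebra_simps)
    finally show ?thesis by simp
  qed
  then have "\<bar>2 * A\<bar> = \<bar>1 - 2 * p\<bar> * ((u / (1 + p * u)) * (w / (1 - p * w)))"
    using u w pos by (simp add: abs_mult)
  also have "\<dots> \<le> 1 * (u * u)"
    using p le1 le2 ge1 ge2 u by (intro mult_mono mult_nonneg_nonneg) auto
  also have "1 * (u * u) \<le> (2 * \<gamma>) * (2 * \<gamma>)"
    unfolding mult_1_left using u \<gamma> by (intro mult_mono) auto
  finally show "\<bar>A\<bar> \<le> 2 * \<gamma>\<^sup>2" by (simp add: power2_eq_square)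
qed

text \<open>Taylor's remainder is at most \<open>exp (y / 2) / 2 * x\<^sup>2\<close>, and
  \<open>x\<^sup>2\<close> is at most \<open>r\<^sup>2 * 8 * exp (y / 2)\<close>: each takes half of
  the exponent \<open>y\<close>. The smallness \<open>r\<^sup>2\<close> is thus separated from an
  exponential moment that does not depend on \<open>r\<close>.\<close>

lemma exp_le_quadratic:
  fixes x r :: real
  assumes "0 < r" "r \<le> 1/2" "\<bar>x\<bar> \<le> r * y"
  shows "exp x \<le> 1 + x + 4 * r\<^sup>2 * exp y"
proof -
  obtain t where t: "\<bar>t\<bar> \<le> \<bar>x\<bar>" "exp x = 1 + x + exp t / 2 * x\<^sup>2"
    using Maclaurin_exp_le[of x 2] by (auto simp: numeral_2_eq_2)
  have y: "0 \<le> y" using assms by (smt (verit) zero_le_mult_iff)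
  have "r * y \<le> 1/2 * y" using assms y by (intro mult_right_mono) auto
  then have "exp t \<le> exp (y / 2)" using t assms by auto
  moreover have "x\<^sup>2 \<le> r\<^sup>2 * (8 * exp (y / 2))"
  proof -
    have "x\<^sup>2 \<le> r\<^sup>2 * y\<^sup>2"
      using power_mono[OF assms(3), of 2] by (simp add: power_mult_distrib)
    also have "\<dots> \<le> r\<^sup>2 * (8 * exp (y / 2))"
      using exp_lower_Taylor_quadratic[of "y / 2"] y by (intro mult_left_mono) (simp_all add: power_divide)
    finally show ?thesis .
  qed
  ultimately have "exp t / 2 * x\<^sup>2 \<le> exp (y / 2) / 2 * (r\<^sup>2 * (8 * exp (y / 2)))"
    by (intro mult_mono) auto
  also have "\<dots> = 4 * r\<^sup>2 * exp y"
    by (simp flip: exp_add)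
  finally show ?thesis using t by simp
qed

text \<open>\<open>\<delta>\<close> bounds the variance of the linear statistic, and every term in
  the bracket is relative to it: \<open>\<gamma>\<^sup>2 N\<close> comes from the constant part
  \<open>A\<^sup>2\<close>, \<open>2 K \<gamma>\<close> from the magnetizations,
  \<open>2 \<gamma>\<close> from exchanging \<open>B\<close> for the slope at 1,
  \<open>2 K\<^sup>2 / N\<close> from the overlap beyond \<open>N\<close>, and the last term from
  the quadratic remainder of the exponential.\<close>

lemma second_moment_excess_le:
  fixes N :: nat and p \<gamma> b \<kappa> \<delta> v K :: real
  defines "v \<equiv> p * (1 - p)" and "\<kappa> \<equiv> edge_coupling p \<gamma>"
    and "\<delta> \<equiv> 4 * (p * (1 - p)) * N * \<gamma>\<^sup>2" and "K \<equiv> 128 / (1 - b)\<^sup>2"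
  assumes p: "0 < p" "p < 1" and \<gamma>: "0 < \<gamma>" "\<gamma> \<le> 1" and N: "N \<ge> 2"
    and b: "2 * real N * \<kappa> \<le> b" "b < 1"
    and \<gamma>N: "\<gamma>\<^sup>2 * N \<le> 1" and \<delta>: "\<delta> \<le> (1 - b) / 32"
  shows "(\<Sum>\<sigma>\<in>spin_configs N. \<Sum>\<tau>\<in>spin_configs N. curie_weiss N \<kappa> \<sigma> * curie_weiss N \<kappa> \<tau> *
       (\<Prod>(i, j)\<in>{1..N} \<times> {1..N}. 1 + v * (edge_slope p \<gamma> (\<sigma> i * \<sigma> j) * edge_slope p \<gamma> (\<tau> i * \<tau> j))))
      - 1 - N * (edge_slope p \<gamma> 1)\<^sup>2 * v
    \<le> \<delta> * (\<gamma>\<^sup>2 * N + 2 * K * \<gamma> + 2 * \<gamma> + 2 * K\<^sup>2 / N + 8192 * exp 1 / (1 - b) ^ 3 * \<delta>)"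
proof -
  let ?C = "curie_weiss N \<kappa>" and ?S = "spin_configs N" and ?m = "magnetization N" and ?o = "overlap N"
  define a where "a = edge_slope p \<gamma> 1"
  define A where "A = (edge_slope p \<gamma> 1 + edge_slope p \<gamma> (-1)) / 2"
  define B where "B = (edge_slope p \<gamma> 1 - edge_slope p \<gamma> (-1)) / 2"
  \<comment> \<open>The exponent for which the exponential moment is bounded; the hypothesis on
    \<open>\<delta>\<close> says precisely that \<open>r \<le> 1/2\<close>.\<close>
  define s where "s = (1 - b) / 16"
  define r where "r = \<delta> / s"
  define T where "T \<sigma> \<tau> = ((?m \<sigma>)\<^sup>2 + (?m \<tau>)\<^sup>2 + (?o \<sigma> \<tau>)\<^sup>2) / N" for \<sigma> \<tau>
  define X where "X \<sigma> \<tau> = v * ((real N)\<^sup>2 * A\<^sup>2 + A * B * ((?m \<sigma>)\<^sup>2 + (?m \<tau>)\<^sup>2) + B\<^sup>2 * (?o \<sigma> \<tau>)\<^sup>2)" for \<sigma> \<tau>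
  have p': "0 \<le> p" "p \<le> 1" and \<gamma>': "0 \<le> \<gamma>" using p \<gamma> by auto
  have \<kappa>: "0 \<le> \<kappa>" unfolding \<kappa>_def using edge_coupling_nonneg[OF p' \<gamma>'] .
  have b0: "0 \<le> b" using \<kappa> b by (smt (verit) mult_nonneg_nonneg of_nat_0_le_iff)
  have v: "0 < v" using p by (simp add: v_def)
  have s: "0 < s" "s \<le> 1" using b b0 by (auto simp: s_def)
  have \<delta>0: "0 < \<delta>" using p \<gamma> N by (auto simp: \<delta>_def)
  have r: "0 < r" "r \<le> 1/2" "r * s = \<delta>" using s \<delta>0 \<delta> by (auto simp: r_def s_def field_simps)
  have K: "0 \<le> K" by (simp add: K_def)
  have slope: "\<bar>A\<bar> \<le> 2 * \<gamma>\<^sup>2" "0 \<le> B" "B \<le> 2 * \<gamma>" "0 \<le> a" "a \<le> 2 * \<gamma>"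
    using edge_slope_bounds[OF p' \<gamma>' \<gamma>(2)] by (simp_all add: A_def B_def a_def)
  have aAB: "a = A + B" by (simp add: a_def A_def B_def field_simps)
  have \<delta>_eq: "\<delta> = v * N * (2 * \<gamma>) * (2 * \<gamma>)" by (simp add: \<delta>_def v_def power2_eq_square)

  have bB: "v * N * (B * B) \<le> \<delta>"
  proof -
    have "v * N * (B * B) \<le> v * N * ((2 * \<gamma>) * (2 * \<gamma>))"
      using slope v \<gamma> by (intro mult_left_mono mult_mono) auto
    then show ?thesis by (simp add: \<delta>_eq ac_simps)
  qed
  have bAB: "v * N * (\<bar>A\<bar> * x) \<le> \<delta> * \<gamma>" if "0 \<le> x" "x \<le> 2 * \<gamma>" for x
  proof -
    have "v * N * (\<bar>A\<bar> * x) \<le> v * N * ((2 * \<gamma>\<^sup>2) * (2 * \<gamma>))"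
      using slope v \<gamma> that by (intro mult_left_mono mult_mono) auto
    then show ?thesis by (simp add: \<delta>_eq ac_simps power2_eq_square)
  qed
  have bA: "v * ((real N)\<^sup>2 * A\<^sup>2) \<le> \<delta> * (\<gamma>\<^sup>2 * N)"
  proof -
    have "v * (real N)\<^sup>2 * (\<bar>A\<bar> * \<bar>A\<bar>) \<le> v * (real N)\<^sup>2 * ((2 * \<gamma>\<^sup>2) * (2 * \<gamma>\<^sup>2))"
      using slope v \<gamma> by (intro mult_left_mono mult_mono) auto
    then show ?thesis by (simp add: \<delta>_eq ac_simps power2_eq_square)
  qed

  have prod_le: "(\<Prod>(i, j)\<in>{1..N} \<times> {1..N}. 1 + v * (edge_slope p \<gamma> (\<sigma> i * \<sigma> j) * edge_slope p \<gamma> (\<tau> i * \<tau> j)))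
      \<le> exp (X \<sigma> \<tau>)" if \<sigma>: "\<sigma> \<in> ?S" and \<tau>: "\<tau> \<in> ?S" for \<sigma> \<tau>
  proof -
    have lin: "edge_slope p \<gamma> (\<sigma> i * \<sigma> j) = A + B * (\<sigma> i * \<sigma> j)"
      if "\<sigma> \<in> ?S" "i \<in> {1..N}" "j \<in> {1..N}" for \<sigma> i j
    proof -
      have "edge_slope p \<gamma> x = A + B * x" if "x = -1 \<or> x = 1" for x
        using that by (auto simp: A_def B_def field_simps)
      then show ?thesis using spin_mult_cases[OF that] .
    qed
    \<comment> \<open>Multiplying the bounds \<open>1 + t \<le> exp t\<close> requires nonnegative
      factors. Each factor is the mean of a product of two normalised edge weights, with values
      \<open>exp (\<gamma> * x) / edge_mean p \<gamma> x\<close> and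
      \<open>1 / edge_mean p \<gamma> x\<close> at the two atoms.\<close>
    have nonneg: "0 \<le> 1 + v * (edge_slope p \<gamma> x * edge_slope p \<gamma> y)" for x y
    proof -
      have pos: "0 < edge_mean p \<gamma> x" for x using edge_mean_pos[OF p'] .
      have plus: "1 + edge_slope p \<gamma> x * (1 - p) = exp (\<gamma> * x) / edge_mean p \<gamma> x" for x
        using pos[of x] by (simp add: edge_slope_def field_simps) (simp add: edge_mean_def algebra_simps)
      have minus: "1 - edge_slope p \<gamma> x * p = 1 / edge_mean p \<gamma> x" for x
        using pos[of x] by (simp add: edge_slope_def field_simps) (simp add: edge_mean_def algebra_simps)
      have "1 + v * (edge_slope p \<gamma> x * edge_slope p \<gamma> y) =
          p * ((1 + edge_slope p \<gamma> x * (1 - p)) * (1 + edge_slope p \<gamma> y * (1 - p)))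
          + (1 - p) * ((1 - edge_slope p \<gamma> x * p) * (1 - edge_slope p \<gamma> y * p))"
        by (simp add: v_def algebra_simps)
      also have "\<dots> \<ge> 0"
        unfolding plus minus using p' pos
        by (intro add_nonneg_nonneg mult_nonneg_nonneg divide_nonneg_nonneg) (auto intro: less_imp_le)
      finally show ?thesis .
    qed
    have "(\<Prod>(i, j)\<in>{1..N} \<times> {1..N}. 1 + v * (edge_slope p \<gamma> (\<sigma> i * \<sigma> j) * edge_slope p \<gamma> (\<tau> i * \<tau> j)))
        \<le> (\<Prod>(i, j)\<in>{1..N} \<times> {1..N}. exp (v * (edge_slope p \<gamma> (\<sigma> i * \<sigma> j) * edge_slope p \<gamma> (\<tau> i * \<tau> j))))"
      using nonneg by (intro prod_mono) auto
    also have "\<dots> = exp (\<Sum>(i, j)\<in>{1..N} \<times> {1..N}. v * (edge_slope p \<gamma> (\<sigma> i * \<sigma> j) * edge_slope p \<gamma> (\<tau> i * \<tau> j)))"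
      by (simp add: exp_sum case_prod_beta)
    also have "(\<Sum>(i, j)\<in>{1..N} \<times> {1..N}. v * (edge_slope p \<gamma> (\<sigma> i * \<sigma> j) * edge_slope p \<gamma> (\<tau> i * \<tau> j))) =
        (\<Sum>(i, j)\<in>{1..N} \<times> {1..N}. v * A\<^sup>2 + v * A * B * (\<sigma> i * \<sigma> j) + v * A * B * (\<tau> i * \<tau> j)
          + v * B\<^sup>2 * ((\<sigma> i * \<sigma> j) * (\<tau> i * \<tau> j)))"
      by (intro sum.cong refl) (auto simp: lin[OF \<sigma>] lin[OF \<tau>] algebra_simps power2_eq_square)
    also have "\<dots> = (\<Sum>(i, j)\<in>{1..N} \<times> {1..N}. v * A\<^sup>2) + v * A * B * (\<Sum>(i, j)\<in>{1..N} \<times> {1..N}. \<sigma> i * \<sigma> j)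
        + v * A * B * (\<Sum>(i, j)\<in>{1..N} \<times> {1..N}. \<tau> i * \<tau> j)
        + v * B\<^sup>2 * (\<Sum>(i, j)\<in>{1..N} \<times> {1..N}. (\<sigma> i * \<sigma> j) * (\<tau> i * \<tau> j))"
      by (simp add: case_prod_beta sum.distrib sum_distrib_left)
    also have "\<dots> = X \<sigma> \<tau>"
      unfolding sum_pairs_spin X_def by (simp add: power2_eq_square algebra_simps)
    finally show ?thesis .
  qed

  \<comment> \<open>After division of the squares by \<open>N\<close>, all three coefficients of
    \<open>X\<close> are at most \<open>\<delta> = r * s\<close>; the constant one uses
    \<open>\<gamma>\<^sup>2 N \<le> 1\<close>, and \<open>s \<le> 1\<close> lets \<open>r\<close>
    absorb it.\<close>
  have X_abs: "\<bar>X \<sigma> \<tau>\<bar> \<le> r * (1 + s * T \<sigma> \<tau>)" for \<sigma> \<tau>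
  proof -
    define M Q where "M = ((?m \<sigma>)\<^sup>2 + (?m \<tau>)\<^sup>2) / N" "Q = (?o \<sigma> \<tau>)\<^sup>2 / N"
    have MQ: "0 \<le> M" "0 \<le> Q" by (auto simp: M_Q_def)
    have "X \<sigma> \<tau> = v * ((real N)\<^sup>2 * A\<^sup>2) + v * N * (A * B) * M + v * N * (B * B) * Q"
      using N by (simp add: X_def M_Q_def power2_eq_square algebra_simps add_divide_distrib)
    then have "\<bar>X \<sigma> \<tau>\<bar> \<le> \<bar>v * ((real N)\<^sup>2 * A\<^sup>2)\<bar> + \<bar>v * N * (A * B) * M\<bar> + \<bar>v * N * (B * B) * Q\<bar>"
      by linarith
    also have "\<dots> = v * ((real N)\<^sup>2 * A\<^sup>2) + v * N * (\<bar>A\<bar> * B) * M + v * N * (B * B) * Q"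
      using v slope MQ by (simp add: abs_mult)
    also have "\<dots> \<le> \<delta> + \<delta> * M + \<delta> * Q"
    proof (intro add_mono mult_right_mono MQ bB)
      have "\<delta> * (\<gamma>\<^sup>2 * N) \<le> \<delta> * 1" using \<delta>0 \<gamma>N by (intro mult_left_mono) auto
      then show "v * ((real N)\<^sup>2 * A\<^sup>2) \<le> \<delta>" using bA by linarith
      have "\<delta> * \<gamma> \<le> \<delta> * 1" using \<delta>0 \<gamma> by (intro mult_left_mono) auto
      then show "v * N * (\<bar>A\<bar> * B) \<le> \<delta>" using bAB[OF slope(2,3)] by linarith
    qed
    also have "\<dots> \<le> r + \<delta> * M + \<delta> * Q"
    proof -
      have "\<delta> \<le> r" using s \<delta>0 by (simp add: r_def le_divide_eq mult_left_le)
      then show ?thesis by simp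
    qed
    also have "\<dots> = r * (1 + s * T \<sigma> \<tau>)"
      using r by (simp add: T_def M_Q_def distrib_left add_divide_distrib flip: mult.assoc)
    finally show ?thesis .
  qed

  have pt: "(\<Prod>(i, j)\<in>{1..N} \<times> {1..N}. 1 + v * (edge_slope p \<gamma> (\<sigma> i * \<sigma> j) * edge_slope p \<gamma> (\<tau> i * \<tau> j)))
      \<le> 1 + X \<sigma> \<tau> + 4 * r\<^sup>2 * exp 1 * exp (s * T \<sigma> \<tau>)" if "\<sigma> \<in> ?S" "\<tau> \<in> ?S" for \<sigma> \<tau>
    using prod_le[OF that] exp_le_quadratic[OF r(1,2) X_abs, of \<sigma> \<tau>] by (simp add: exp_add)

  define E where "E f = (\<Sum>\<sigma>\<in>?S. \<Sum>\<tau>\<in>?S. ?C \<sigma> * ?C \<tau> * f \<sigma> \<tau>)" for f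
  have E_mono: "E f \<le> E g" if "\<And>\<sigma> \<tau>. \<sigma> \<in> ?S \<Longrightarrow> \<tau> \<in> ?S \<Longrightarrow> f \<sigma> \<tau> \<le> g \<sigma> \<tau>" for f g
    unfolding E_def by (intro sum_mono mult_left_mono mult_nonneg_nonneg curie_weiss_nonneg that)
  have E_add: "E (\<lambda>\<sigma> \<tau>. f \<sigma> \<tau> + g \<sigma> \<tau>) = E f + E g" for f g
    by (simp add: E_def distrib_left sum.distrib)
  have E_cmult: "E (\<lambda>\<sigma> \<tau>. c * f \<sigma> \<tau>) = c * E f" for f c
    by (simp add: E_def sum_distrib_left ac_simps)
  have E_left: "E (\<lambda>\<sigma> \<tau>. f \<sigma>) = (\<Sum>\<sigma>\<in>?S. ?C \<sigma> * f \<sigma>)" for f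
    by (simp add: E_def sum_curie_weiss flip: sum_distrib_left sum_distrib_right)
  have E_right: "E (\<lambda>\<sigma> \<tau>. f \<tau>) = (\<Sum>\<sigma>\<in>?S. ?C \<sigma> * f \<sigma>)" for f
    unfolding E_def by (subst sum.swap) (simp add: sum_curie_weiss flip: sum_distrib_left sum_distrib_right)
  have E_const: "E (\<lambda>\<sigma> \<tau>. c) = c" for c
    unfolding E_left by (simp add: sum_curie_weiss flip: sum_distrib_right)

  define m2 where "m2 = (\<Sum>\<sigma>\<in>?S. ?C \<sigma> * (?m \<sigma>)\<^sup>2)"
  define o2 where "o2 = E (\<lambda>\<sigma> \<tau>. (?o \<sigma> \<tau>)\<^sup>2)"
  have m2: "0 \<le> m2" "m2 \<le> K * N"
  proof -
    show "0 \<le> m2" unfolding m2_def by (intro sum_nonneg mult_nonneg_nonneg curie_weiss_nonneg) auto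
    show "m2 \<le> K * N" unfolding m2_def K_def
      by (rule curie_weiss_magnetization_square_le) (use N \<kappa> b in auto)
  qed
  have o2: "o2 \<le> N + 2 * K\<^sup>2"
    unfolding o2_def E_def K_def by (intro curie_weiss_overlap_square_le N \<kappa> b)
  have eT: "E (\<lambda>\<sigma> \<tau>. exp (s * T \<sigma> \<tau>)) \<le> 8 / (1 - b)"
    unfolding E_def s_def T_def using N by (intro overlap_square_moment_exp \<kappa> b) auto
  have EX: "E X = v * ((real N)\<^sup>2 * A\<^sup>2) + 2 * (v * A * B * m2) + v * B\<^sup>2 * o2"
  proof -
    have "E X = E (\<lambda>\<sigma> \<tau>. v * ((real N)\<^sup>2 * A\<^sup>2) + v * A * B * (?m \<sigma>)\<^sup>2 + v * A * B * (?m \<tau>)\<^sup>2 + v * B\<^sup>2 * (?o \<sigma> \<tau>)\<^sup>2)"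
      by (rule arg_cong[of _ _ E]) (intro ext, simp add: X_def algebra_simps)
    also have "\<dots> = v * ((real N)\<^sup>2 * A\<^sup>2) + 2 * (v * A * B * m2) + v * B\<^sup>2 * o2"
      by (simp add: E_add E_cmult E_const E_left E_right m2_def o2_def)
    finally show ?thesis .
  qed
  have EX_le: "E X - N * a\<^sup>2 * v \<le> \<delta> * (\<gamma>\<^sup>2 * N + 2 * K * \<gamma> + 2 * \<gamma> + 2 * K\<^sup>2 / N)"
  proof -
    have 1: "v * A * B * m2 \<le> \<delta> * \<gamma> * K"
    proof -
      have "v * A * B * m2 \<le> v * (\<bar>A\<bar> * B) * (K * N)"
      proof (rule mult_mono)
        have "v * (A * B) \<le> v * (\<bar>A\<bar> * B)"
          using v slope by (intro mult_left_mono mult_right_mono) auto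
        then show "v * A * B \<le> v * (\<bar>A\<bar> * B)" by (simp add: mult.assoc)
      qed (use v slope m2 in auto)
      also have "\<dots> = v * N * (\<bar>A\<bar> * B) * K" by simp
      also have "\<dots> \<le> \<delta> * \<gamma> * K" by (intro mult_right_mono bAB slope K)
      finally show ?thesis .
    qed
    have 2: "v * B\<^sup>2 * o2 \<le> v * N * (B * B) + \<delta> * (2 * K\<^sup>2 / N)"
    proof -
      have "v * B\<^sup>2 * o2 \<le> v * B\<^sup>2 * (N + 2 * K\<^sup>2)" using v o2 by (intro mult_left_mono) auto
      also have "\<dots> = v * N * (B * B) + v * N * (B * B) * (2 * K\<^sup>2 / N)"
        using N by (simp add: algebra_simps power2_eq_square)
      also have "\<dots> \<le> v * N * (B * B) + \<delta> * (2 * K\<^sup>2 / N)"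
        by (intro add_left_mono mult_right_mono bB) auto
      finally show ?thesis .
    qed
    \<comment> \<open>The decisive cancellation: the leading overlap term meets the variance of the
      linear statistic, and \<open>B\<^sup>2 - a\<^sup>2 = - A * (B + a)\<close> is of third order
      in \<open>\<gamma>\<close>.\<close>
    have 3: "v * N * (B * B) - N * a\<^sup>2 * v \<le> 2 * (\<delta> * \<gamma>)"
    proof -
      have "v * N * (B * B) - N * a\<^sup>2 * v = - (v * N * (A * B)) - v * N * (A * a)"
        unfolding aAB by (simp add: algebra_simps power2_eq_square)
      also have "\<dots> \<le> v * N * (\<bar>A\<bar> * B) + v * N * (\<bar>A\<bar> * a)"
      proof -
        have "- (v * N * (A * x)) \<le> v * N * (\<bar>A\<bar> * x)" if "0 \<le> x" for x
        proof -
          have "(v * N * x) * (- A) \<le> (v * N * x) * \<bar>A\<bar>"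
            using v that by (intro mult_left_mono) auto
          then show ?thesis by (simp add: ac_simps)
        qed
        from this[of B] this[of a] slope show ?thesis by linarith
      qed
      also have "\<dots> \<le> \<delta> * \<gamma> + \<delta> * \<gamma>" by (intro add_mono bAB slope)
      finally show ?thesis by simp
    qed
    have "E X - N * a\<^sup>2 * v \<le> \<delta> * (\<gamma>\<^sup>2 * N) + 2 * (\<delta> * \<gamma> * K) + 2 * (\<delta> * \<gamma>) + \<delta> * (2 * K\<^sup>2 / N)"
      unfolding EX using bA 1 2 3 by linarith
    then show ?thesis by (simp add: algebra_simps)
  qed
  have "E (\<lambda>\<sigma> \<tau>. \<Prod>(i, j)\<in>{1..N} \<times> {1..N}. 1 + v * (edge_slope p \<gamma> (\<sigma> i * \<sigma> j) * edge_slope p \<gamma> (\<tau> i * \<tau> j)))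
      \<le> E (\<lambda>\<sigma> \<tau>. 1 + X \<sigma> \<tau> + 4 * r\<^sup>2 * exp 1 * exp (s * T \<sigma> \<tau>))"
    by (intro E_mono pt)
  also have "\<dots> = 1 + E X + 4 * r\<^sup>2 * exp 1 * E (\<lambda>\<sigma> \<tau>. exp (s * T \<sigma> \<tau>))"
    by (simp add: E_add E_const E_cmult)
  also have "\<dots> \<le> 1 + E X + 4 * r\<^sup>2 * exp 1 * (8 / (1 - b))"
    using eT by (intro add_left_mono mult_left_mono) auto
  \<comment> \<open>\<open>r = 16 * \<delta> / (1 - b)\<close>, and
    \<open>8192 = 4 * 16\<^sup>2 * 8\<close>.\<close>
  also have "4 * r\<^sup>2 * exp 1 * (8 / (1 - b)) = \<delta> * (8192 * exp 1 / (1 - b) ^ 3 * \<delta>)"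
    using b by (simp add: r_def s_def power2_eq_square power3_eq_cube)
  finally show ?thesis
    using EX_le unfolding E_def a_def by (simp add: distrib_left)
qed

section \<open>Characteristic functions and the limit theorem\<close>

lemma centered_normal_eq_distr:
  assumes "0 < v"
  shows "centered_normal v = distr std_normal_distribution borel (\<lambda>x. sqrt v * x)"
proof -
  interpret prob_space std_normal_distribution
    by (rule prob_space_normal_density) simp
  have "distributed std_normal_distribution lborel (\<lambda>x. x) std_normal_density"
    by (simp add: distributed_def distr_id2)
  from normal_density_affine[OF this, of "sqrt v" 0]
  have "distr std_normal_distribution lborel (\<lambda>x. sqrt v * x) = density lborel (normal_density 0 (sqrt v))"
    using assms by (simp add: distributed_def)
  moreover have "distr std_normal_distribution lborel (\<lambda>x. sqrt v * x) = distr std_normal_distribution borel (\<lambda>x. sqrt v * x)"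
    by (intro distr_cong) auto
  ultimately show ?thesis by (simp add: centered_normal_def)
qed

lemma real_distribution_centered_normal:
  assumes "0 < v"
  shows "real_distribution (centered_normal v)"
proof -
  interpret prob_space std_normal_distribution
    by (rule prob_space_normal_density) simp
  show ?thesis unfolding centered_normal_eq_distr[OF assms] by (intro real_distribution_distr) auto
qed

lemma char_centered_normal:
  assumes "0 < v"
  shows "char (centered_normal v) t = complex_of_real (exp (- (t\<^sup>2 * v) / 2))"
proof -
  have "char (centered_normal v) t = char std_normal_distribution (t * sqrt v)"
    unfolding centered_normal_eq_distr[OF assms] char_def
    by (subst integral_distr) (auto simp: mult.assoc)
  then show ?thesis
    using assms by (simp add: char_std_normal_distribution power_mult_distrib)
qed

text \<open>\<open>x \<mapsto> exp (i t x)\<close> is Lipschitz with constant \<open>|t|\<close>,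
  and the first absolute moment is at most the root of the second. It carries the limit law from the
  linear statistic to the partition function.\<close>

lemma (in prob_space) char_diff_le:
  assumes [measurable]: "X \<in> borel_measurable M" "Y \<in> borel_measurable M"
    and int: "has_bochner_integral M (\<lambda>\<omega>. (X \<omega> - Y \<omega>)\<^sup>2) d"
  shows "cmod (char (distr M borel X) t - char (distr M borel Y) t) \<le> \<bar>t\<bar> * sqrt d"
proof -
  define W where "W \<omega> = \<bar>X \<omega> - Y \<omega>\<bar>" for \<omega>
  have W2: "(\<lambda>\<omega>. (W \<omega>)\<^sup>2) = (\<lambda>\<omega>. (X \<omega> - Y \<omega>)\<^sup>2)" by (simp add: W_def)
  have [measurable]: "W \<in> borel_measurable M" unfolding W_def by measurable
  have intW2: "integrable M (\<lambda>\<omega>. (W \<omega>)\<^sup>2)" "expectation (\<lambda>\<omega>. (W \<omega>)\<^sup>2) = d"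
    using int unfolding W2 by (auto simp: has_bochner_integral_iff)
  have intW: "integrable M W"
    by (rule square_integrable_imp_integrable) (measurable, rule intW2)
  have "(expectation W)\<^sup>2 \<le> d"
    using variance_eq[OF intW intW2(1)] variance_positive[of W] unfolding intW2(2) by linarith
  then have EW: "expectation W \<le> sqrt d" by (rule real_le_rsqrt)
  have i: "integrable M (\<lambda>\<omega>. iexp (t * X \<omega>))" "integrable M (\<lambda>\<omega>. iexp (t * Y \<omega>))"
    by (auto intro!: integrable_const_bound[where B = 1])
  have pt: "cmod (iexp (t * X \<omega>) - iexp (t * Y \<omega>)) \<le> \<bar>t\<bar> * W \<omega>" for \<omega>
  proof -
    have "iexp (t * X \<omega>) = iexp (t * Y \<omega>) * iexp (t * (X \<omega> - Y \<omega>))"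
      unfolding exp_add[symmetric] by (simp add: algebra_simps)
    then have "iexp (t * X \<omega>) - iexp (t * Y \<omega>) = iexp (t * Y \<omega>) * (iexp (t * (X \<omega> - Y \<omega>)) - 1)"
      by (simp only: right_diff_distrib mult_1_right)
    then have "cmod (iexp (t * X \<omega>) - iexp (t * Y \<omega>)) = cmod (iexp (t * (X \<omega> - Y \<omega>)) - 1)"
      by (simp only: norm_mult norm_exp_i_times mult_1_left)
    also have "\<dots> \<le> \<bar>t * (X \<omega> - Y \<omega>)\<bar>"
      using iexp_approx1[of "t * (X \<omega> - Y \<omega>)" 0] by simp
    finally show ?thesis by (simp add: W_def abs_mult)
  qed
  have "char (distr M borel X) t - char (distr M borel Y) t = (CLINT \<omega>|M. iexp (t * X \<omega>) - iexp (t * Y \<omega>))"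
  proof -
    have "char (distr M borel V) t = (CLINT \<omega>|M. iexp (t * V \<omega>))" if "V \<in> borel_measurable M" for V
      unfolding char_def using that by (subst integral_distr) auto
    then show ?thesis
      using Bochner_Integration.integral_diff[OF i] assms(1,2) by metis
  qed
  also have "cmod \<dots> \<le> (\<integral>\<omega>. cmod (iexp (t * X \<omega>) - iexp (t * Y \<omega>)) \<partial>M)"
    by (rule integral_norm_bound)
  also have "\<dots> \<le> (\<integral>\<omega>. \<bar>t\<bar> * W \<omega> \<partial>M)"
    by (intro integral_mono pt integrable_norm Bochner_Integration.integrable_diff integrable_mult_right i intW)
  also have "\<dots> \<le> \<bar>t\<bar> * sqrt d"
    using EW by (simp add: mult_left_mono)
  finally show ?thesis .
qed

text \<open>Second-order expansion at both atoms, where centring removes the linear terms. The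
  variance stays as a factor of the error because \<open>p\<close> may approach 0 or 1: multiplied
  by \<open>N\<close>, the error is then a convergent sequence times
  \<open>|\<theta>| + \<theta>\<^sup>2\<close>.\<close>

lemma centered_bernoulli_char_approx:
  fixes p \<theta> :: real
  assumes p: "0 \<le> p" "p \<le> 1"
  shows "cmod (p * iexp (\<theta> * (1 - p)) + (1 - p) * iexp (\<theta> * (0 - p)) - exp (- (\<theta>\<^sup>2 * (p * (1 - p)) / 2)))
    \<le> \<theta>\<^sup>2 * (p * (1 - p)) * (\<bar>\<theta>\<bar> + \<theta>\<^sup>2)"
proof -
  define q y where "q = 1 - p" "y = \<theta>\<^sup>2 * (p * q) / 2"
  have q: "0 \<le> q" "q \<le> 1" "p + q = 1" using p by (auto simp: q_y_def)
  have y: "0 \<le> y" using p q by (simp add: q_y_def)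
  define R where "R x = iexp x - (1 + \<i> * x - x\<^sup>2 / 2)" for x :: real
  have R: "cmod (R x) \<le> \<bar>x\<bar> ^ 3 / 6" for x
    using iexp_approx1[of x 2]
    by (simp add: R_def eval_nat_numeral power2_eq_square algebra_simps)
  have "p * iexp (\<theta> * (1 - p)) + (1 - p) * iexp (\<theta> * (0 - p)) - exp (- y) =
      p * R (\<theta> * q) + q * R (- (\<theta> * p)) + complex_of_real ((1 - y) - exp (- y))"
  proof -
    have "p * (1 + \<i> * (\<theta> * q) - (\<theta> * q)\<^sup>2 / 2) + q * (1 + \<i> * (- (\<theta> * p)) - (- (\<theta> * p))\<^sup>2 / 2)
        = complex_of_real ((p + q) - \<theta>\<^sup>2 * (p * q) * (p + q) / 2)"
      by (simp add: algebra_simps power2_eq_square)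
    also have "\<dots> = complex_of_real (1 - y)"
      unfolding q(3) by (simp add: q_y_def)
    finally show ?thesis
      by (simp add: R_def q_y_def(1)[symmetric] algebra_simps)
  qed
  also have "cmod \<dots> \<le> p * (\<bar>\<theta> * q\<bar> ^ 3 / 6) + q * (\<bar>\<theta> * p\<bar> ^ 3 / 6) + y\<^sup>2 / 2"
  proof (intro order.trans[OF norm_triangle_ineq] add_mono)
    show "cmod (p * R (\<theta> * q)) \<le> p * (\<bar>\<theta> * q\<bar> ^ 3 / 6)" "cmod (q * R (- (\<theta> * p))) \<le> q * (\<bar>\<theta> * p\<bar> ^ 3 / 6)"
      using mult_left_mono[OF R[of "\<theta> * q"] p(1)] mult_left_mono[OF R[of "- (\<theta> * p)"] q(1)] p q
      by (simp_all add: norm_mult)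
    \<comment> \<open>A nonpositive intermediate point gives \<open>exp t \<le> 1\<close>, so the
      remainder is at most \<open>y\<^sup>2 / 2\<close>; \<open>y = 0\<close> is separate since the
      expansion is taken at a strictly negative argument.\<close>
    obtain t where t: "\<bar>t\<bar> \<le> \<bar>- y\<bar>" "exp (- y) = 1 - y + exp t / 2 * y\<^sup>2"
      "t \<le> 0"
    proof (cases "y = 0")
      case False
      then obtain t where "- y < t" "t < 0" "exp (- y) = 1 - y + exp t / 2 * y\<^sup>2"
        using Maclaurin_minus[of "- y" 2 "\<lambda>_. exp" exp] y
        by (auto simp: numeral_2_eq_2)
      then show ?thesis using that[of t] by auto
    qed (use that[of 0] in auto)
    then have "0 \<le> exp t / 2 * y\<^sup>2" "exp t / 2 * y\<^sup>2 \<le> 1 / 2 * y\<^sup>2"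
      using mult_right_mono[of "exp t / 2" "1 / 2" "y\<^sup>2"] by auto
    then have "\<bar>(1 - y) - exp (- y)\<bar> \<le> y\<^sup>2 / 2"
      using t(2) by simp
    then show "cmod (complex_of_real ((1 - y) - exp (- y))) \<le> y\<^sup>2 / 2"
      unfolding norm_of_real .
  qed
  also have "\<dots> \<le> \<theta>\<^sup>2 * (p * q) * (\<bar>\<theta>\<bar> + \<theta>\<^sup>2)"
  proof -
    \<comment> \<open>\<open>p q\<^sup>3 + q p\<^sup>3 = p q (q\<^sup>2 + p\<^sup>2)\<close>
      recovers the variance from the third absolute moment.\<close>
    have "p * (\<bar>\<theta> * q\<bar> ^ 3 / 6) + q * (\<bar>\<theta> * p\<bar> ^ 3 / 6) = \<theta>\<^sup>2 * (p * q) * (\<bar>\<theta>\<bar> * ((q\<^sup>2 + p\<^sup>2) / 6))"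
    proof -
      have cube: "\<bar>\<theta> * x\<bar> ^ 3 = \<theta>\<^sup>2 * \<bar>\<theta>\<bar> * x ^ 3" if "0 \<le> x" for x
        using that by (simp add: abs_mult power_mult_distrib power2_eq_square power3_eq_cube)
      show ?thesis
        unfolding cube[OF p(1)] cube[OF q(1)] by (simp add: power2_eq_square power3_eq_cube algebra_simps add_divide_distrib)
    qed
    also have "\<dots> \<le> \<theta>\<^sup>2 * (p * q) * (\<bar>\<theta>\<bar> * 1)"
    proof -
      have "q\<^sup>2 \<le> 1" "p\<^sup>2 \<le> 1" using p q by (auto intro: power_le_one)
      then show ?thesis using p q by (intro mult_left_mono) auto
    qed
    finally have 1: "p * (\<bar>\<theta> * q\<bar> ^ 3 / 6) + q * (\<bar>\<theta> * p\<bar> ^ 3 / 6) \<le> \<theta>\<^sup>2 * (p * q) * \<bar>\<theta>\<bar>" by simp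
    have "y\<^sup>2 / 2 = \<theta>\<^sup>2 * (p * q) * (\<theta>\<^sup>2 * ((p * q) / 8))"
      by (simp add: q_y_def(2) power2_eq_square)
    also have "\<dots> \<le> \<theta>\<^sup>2 * (p * q) * (\<theta>\<^sup>2 * 1)"
    proof -
      have "p * q \<le> 1" using p q by (simp add: mult_le_one)
      then show ?thesis using p q by (intro mult_left_mono) auto
    qed
    finally show ?thesis using 1 by (simp add: distrib_left)
  qed
  finally show ?thesis by (simp add: q_y_def)
qed

lemma (in bernoulli_family) char_linear_statistic:
  assumes D: "D \<subseteq> I"
  shows "char (distr M borel (\<lambda>\<omega>. c * (\<Sum>i\<in>D. X i \<omega> - p))) t =
    (p * iexp (t * c * (1 - p)) + (1 - p) * iexp (t * c * (0 - p))) ^ card D"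
proof -
  have finD: "finite D" using D finite_I finite_subset by blast
  have rv: "(\<lambda>\<omega>. c * (\<Sum>i\<in>D. X i \<omega> - p)) \<in> borel_measurable M"
    using D by (intro borel_measurable_times borel_measurable_const borel_measurable_sum borel_measurable_diff measurable_X) auto
  have "has_bochner_integral M (\<lambda>\<omega>. \<Prod>i\<in>I. if i \<in> D then iexp (t * c * (X i \<omega> - p)) else 1)
    (\<Prod>i\<in>I. p *\<^sub>R (if i \<in> D then iexp (t * c * (1 - p)) else 1) + (1 - p) *\<^sub>R (if i \<in> D then iexp (t * c * (0 - p)) else 1))"
    by (rule has_expectation_prod) measurable
  moreover have "(\<Prod>i\<in>I. if i \<in> D then iexp (t * c * (X i \<omega> - p)) else 1) = iexp (t * (c * (\<Sum>i\<in>D. X i \<omega> - p)))" for \<omega>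
  proof -
    have "(\<Prod>i\<in>I. if i \<in> D then iexp (t * c * (X i \<omega> - p)) else 1) = (\<Prod>i\<in>D. iexp (t * c * (X i \<omega> - p)))"
      using D finite_I by (simp add: prod.inter_restrict[symmetric] Int_absorb1)
    also have "\<dots> = exp (\<Sum>i\<in>D. \<i> * complex_of_real (t * c * (X i \<omega> - p)))"
      using finD by (simp add: exp_sum)
    also have "(\<Sum>i\<in>D. \<i> * complex_of_real (t * c * (X i \<omega> - p))) = \<i> * complex_of_real (t * (c * (\<Sum>i\<in>D. X i \<omega> - p)))"
      by (simp only: sum_distrib_left of_real_sum mult.assoc)
    finally show ?thesis .
  qed
  moreover have "(\<Prod>i\<in>I. p *\<^sub>R (if i \<in> D then iexp (t * c * (1 - p)) else 1) + (1 - p) *\<^sub>R (if i \<in> D then iexp (t * c * (0 - p)) else 1))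
      = (p * iexp (t * c * (1 - p)) + (1 - p) * iexp (t * c * (0 - p))) ^ card D"
  proof -
    have "(\<Prod>i\<in>I. p *\<^sub>R (if i \<in> D then iexp (t * c * (1 - p)) else 1) + (1 - p) *\<^sub>R (if i \<in> D then iexp (t * c * (0 - p)) else 1))
      = (\<Prod>i\<in>I. if i \<in> D then p * iexp (t * c * (1 - p)) + (1 - p) * iexp (t * c * (0 - p)) else 1)"
      by (intro prod.cong refl) (auto simp: scaleR_conv_of_real simp flip: of_real_add)
    also have "\<dots> = (\<Prod>i\<in>D. p * iexp (t * c * (1 - p)) + (1 - p) * iexp (t * c * (0 - p)))"
      using D finite_I by (simp add: prod.inter_restrict[symmetric] Int_absorb1)
    finally show ?thesis by simp
  qed
  ultimately have "(CLINT \<omega>|M. iexp (t * (c * (\<Sum>i\<in>D. X i \<omega> - p)))) = (p * iexp (t * c * (1 - p)) + (1 - p) * iexp (t * c * (0 - p))) ^ card D"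
    by (simp only: has_bochner_integral_iff)
  then show ?thesis
    unfolding char_def by (subst integral_distr[OF rv]) auto
qed

section \<open>The partition function as an average of products over edges\<close>

lemma partition_function_eq_sum_prod:
  "partition_function N p \<beta> e =
    (\<Sum>\<sigma>\<in>spin_configs N. \<Prod>ij\<in>{1..N} \<times> {1..N}. exp (\<beta> / (2 * real N * p) * (\<sigma> (fst ij) * \<sigma> (snd ij)) * e (fst ij) (snd ij)))"
  unfolding partition_function_def
proof (intro sum.cong refl)
  fix \<sigma>
  have "- \<beta> * hamiltonian N p e \<sigma> =
      (\<Sum>ij\<in>{1..N} \<times> {1..N}. \<beta> / (2 * real N * p) * (\<sigma> (fst ij) * \<sigma> (snd ij)) * e (fst ij) (snd ij))"
    by (simp add: hamiltonian_def sum.cartesian_product case_prod_beta sum_distrib_left mult.assoc)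
  then show "exp (- \<beta> * hamiltonian N p e \<sigma>) =
      (\<Prod>ij\<in>{1..N} \<times> {1..N}. exp (\<beta> / (2 * real N * p) * (\<sigma> (fst ij) * \<sigma> (snd ij)) * e (fst ij) (snd ij)))"
    by (simp add: exp_sum)
qed

lemma exp_eq_edge_mean_slope:
  assumes "0 \<le> p" "p \<le> 1" "e = 0 \<or> e = 1"
  shows "exp (\<gamma> * x * e) = edge_mean p \<gamma> x * (1 + edge_slope p \<gamma> x * (e - p))"
proof -
  have "edge_mean p \<gamma> x * (1 + edge_slope p \<gamma> x * (e - p)) = edge_mean p \<gamma> x + (exp (\<gamma> * x) - 1) * (e - p)"
    using edge_mean_pos[OF assms(1,2), of \<gamma> x] by (simp add: edge_slope_def distrib_left)
  then show ?thesis using assms(3) by (auto simp: edge_mean_def algebra_simps)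
qed

locale random_graph = bernoulli_family M "{1..N} \<times> {1..N}" "\<lambda>(i, j). e i j" p
  for M :: "'a measure" and N :: nat and e :: "nat \<Rightarrow> nat \<Rightarrow> 'a \<Rightarrow> real" and p :: real +
  assumes p_pos: "0 < p" and p_le_1: "p \<le> 1"
begin

lemma measurable_edge [measurable]: "i \<in> {1..N} \<Longrightarrow> j \<in> {1..N} \<Longrightarrow> e i j \<in> borel_measurable M"
  using measurable_X[of "(i, j)"] by simp

lemma measurable_partition_function [measurable]:
  "(\<lambda>\<omega>. partition_function N p \<beta> (\<lambda>i j. e i j \<omega>)) \<in> borel_measurable M"
  unfolding partition_function_def hamiltonian_def by measurable

text \<open>The orthogonal decomposition for Curie--Weiss weights, with ordered pairs as indices and
  the diagonal as \<open>D\<close>: there \<open>\<sigma> i * \<sigma> i = 1\<close>, so the slope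
  is the same for every configuration.\<close>

lemma partition_function_square_error:
  fixes \<beta> :: real
  defines "Z \<equiv> \<lambda>\<omega>. partition_function N p \<beta> (\<lambda>i j. e i j \<omega>)" and "\<gamma> \<equiv> \<beta> / (2 * real N * p)"
  shows "has_bochner_integral M
    (\<lambda>\<omega>. (Z \<omega> / expectation Z - 1 - edge_slope p \<gamma> 1 * (\<Sum>i=1..N. e i i \<omega> - p))\<^sup>2)
    ((\<Sum>\<sigma>\<in>spin_configs N. \<Sum>\<tau>\<in>spin_configs N. curie_weiss N (edge_coupling p \<gamma>) \<sigma> * curie_weiss N (edge_coupling p \<gamma>) \<tau> *
       (\<Prod>(i, j)\<in>{1..N} \<times> {1..N}. 1 + p * (1 - p) * (edge_slope p \<gamma> (\<sigma> i * \<sigma> j) * edge_slope p \<gamma> (\<tau> i * \<tau> j))))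
      - 1 - N * (edge_slope p \<gamma> 1)\<^sup>2 * (p * (1 - p)))"
proof -
  let ?S = "spin_configs N" and ?I = "{1..N} \<times> {1..N}"
  let ?C = "curie_weiss N (edge_coupling p \<gamma>)"
  define x where "x \<sigma> ij = \<sigma> (fst ij) * \<sigma> (snd ij)" for \<sigma> :: "nat \<Rightarrow> real" and ij
  define X where "X ij \<omega> = e (fst ij) (snd ij) \<omega>" for ij \<omega>
  have X_eq: "(\<lambda>(i, j). e i j) = X" by (auto simp: X_def fun_eq_iff)
  note p = less_imp_le[OF p_pos] p_le_1
  define w where "w \<sigma> = (\<Prod>ij\<in>?I. edge_mean p \<gamma> (x \<sigma> ij))" for \<sigma>
  have Z_eq: "Z \<omega> = (\<Sum>\<sigma>\<in>?S. \<Prod>ij\<in>?I. exp (\<gamma> * x \<sigma> ij * X ij \<omega>))" for \<omega>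
    unfolding Z_def partition_function_eq_sum_prod \<gamma>_def x_def X_def ..
  have EZ: "expectation Z = (\<Sum>\<sigma>\<in>?S. w \<sigma>)"
  proof -
    have "has_bochner_integral M (\<lambda>\<omega>. \<Sum>\<sigma>\<in>?S. \<Prod>ij\<in>?I. exp (\<gamma> * x \<sigma> ij * X ij \<omega>))
        (\<Sum>\<sigma>\<in>?S. \<Prod>ij\<in>?I. p *\<^sub>R exp (\<gamma> * x \<sigma> ij * 1) + (1 - p) *\<^sub>R exp (\<gamma> * x \<sigma> ij * 0))"
      unfolding X_eq[symmetric] by (intro has_bochner_integral_sum has_expectation_prod) measurable
    also have "(\<Sum>\<sigma>\<in>?S. \<Prod>ij\<in>?I. p *\<^sub>R exp (\<gamma> * x \<sigma> ij * 1) + (1 - p) *\<^sub>R exp (\<gamma> * x \<sigma> ij * 0)) = (\<Sum>\<sigma>\<in>?S. w \<sigma>)"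
      unfolding w_def edge_mean_def by (intro sum.cong prod.cong refl) (simp add: algebra_simps)
    finally show ?thesis
      unfolding Z_eq[abs_def] by (simp add: has_bochner_integral_iff)
  qed
  have cw: "w \<sigma> / expectation Z = ?C \<sigma>" if "\<sigma> \<in> ?S" for \<sigma>
    using edge_mean_normalized_eq_curie_weiss[OF p that, of \<gamma>]
    unfolding EZ w_def x_def by (simp add: case_prod_beta)
  have ZE: "AE \<omega> in M. Z \<omega> / expectation Z =
      (\<Sum>\<sigma>\<in>?S. ?C \<sigma> * (\<Prod>ij\<in>?I. 1 + edge_slope p \<gamma> (x \<sigma> ij) * (X ij \<omega> - p)))"
    using AE_X_all
  proof eventually_elim
    case (elim \<omega>)
    then have X01: "X ij \<omega> = 0 \<or> X ij \<omega> = 1" if "ij \<in> ?I" for ij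
      using that by (cases ij) (auto simp: X_def)
    have "Z \<omega> = (\<Sum>\<sigma>\<in>?S. w \<sigma> * (\<Prod>ij\<in>?I. 1 + edge_slope p \<gamma> (x \<sigma> ij) * (X ij \<omega> - p)))"
      unfolding Z_eq w_def prod.distrib[symmetric]
      by (intro sum.cong prod.cong refl exp_eq_edge_mean_slope p X01)
    then have "Z \<omega> / expectation Z = (\<Sum>\<sigma>\<in>?S. w \<sigma> / expectation Z * (\<Prod>ij\<in>?I. 1 + edge_slope p \<gamma> (x \<sigma> ij) * (X ij \<omega> - p)))"
      by (simp add: sum_divide_distrib)
    then show ?case by (simp add: cw cong: sum.cong)
  qed
  define D where "D = (\<lambda>i. (i, i)) ` {1..N}"
  have D: "D \<subseteq> ?I" "card D = N" "(\<Sum>ij\<in>D. X ij \<omega> - p) = (\<Sum>i=1..N. e i i \<omega> - p)" for \<omega>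
    by (auto simp: D_def card_image inj_on_def sum.reindex X_def)
  have slope_D: "edge_slope p \<gamma> (x \<sigma> ij) = edge_slope p \<gamma> 1" if "\<sigma> \<in> ?S" "ij \<in> D" for \<sigma> ij
    using that by (auto simp: x_def D_def spin_square)
  have main: "has_bochner_integral M
    (\<lambda>\<omega>. ((\<Sum>\<sigma>\<in>?S. ?C \<sigma> * (\<Prod>ij\<in>?I. 1 + edge_slope p \<gamma> (x \<sigma> ij) * (X ij \<omega> - p))) - 1
        - edge_slope p \<gamma> 1 * (\<Sum>i=1..N. e i i \<omega> - p))\<^sup>2)
    ((\<Sum>\<sigma>\<in>?S. \<Sum>\<tau>\<in>?S. ?C \<sigma> * ?C \<tau> *
        (\<Prod>ij\<in>?I. 1 + p * (1 - p) * (edge_slope p \<gamma> (x \<sigma> ij) * edge_slope p \<gamma> (x \<tau> ij))))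
      - 1 - N * (edge_slope p \<gamma> 1)\<^sup>2 * (p * (1 - p)))"
    using square_error_expectation[where g = ?C and \<alpha> = "\<lambda>\<sigma> ij. edge_slope p \<gamma> (x \<sigma> ij)",
        OF sum_curie_weiss D(1) slope_D]
    unfolding X_eq D by simp
  show ?thesis
  proof (subst has_bochner_integral_cong_AE)
    show "AE \<omega> in M. (Z \<omega> / expectation Z - 1 - edge_slope p \<gamma> 1 * (\<Sum>i=1..N. e i i \<omega> - p))\<^sup>2 =
        ((\<Sum>\<sigma>\<in>?S. ?C \<sigma> * (\<Prod>ij\<in>?I. 1 + edge_slope p \<gamma> (x \<sigma> ij) * (X ij \<omega> - p))) - 1
        - edge_slope p \<gamma> 1 * (\<Sum>i=1..N. e i i \<omega> - p))\<^sup>2"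
      using ZE by eventually_elim simp
    show "(\<lambda>\<omega>. (Z \<omega> / expectation Z - 1 - edge_slope p \<gamma> 1 * (\<Sum>i=1..N. e i i \<omega> - p))\<^sup>2) \<in> borel_measurable M"
      unfolding Z_def by measurable
  qed (use main in \<open>auto simp: case_prod_beta x_def has_bochner_integral_iff\<close>)
qed

end

lemma (in random_graph) char_diagonal_statistic:
  "char (distr M borel (\<lambda>\<omega>. c * (\<Sum>i=1..N. e i i \<omega> - p))) t =
    (p * iexp (t * c * (1 - p)) + (1 - p) * iexp (t * c * (0 - p))) ^ N"
proof -
  define D where "D = (\<lambda>i. (i, i)) ` {1..N}"
  have D: "D \<subseteq> {1..N} \<times> {1..N}" "card D = N"
    "(\<Sum>ij\<in>D. (case ij of (i, j) \<Rightarrow> e i j) \<omega> - p) = (\<Sum>i=1..N. e i i \<omega> - p)" for \<omega>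
    by (auto simp: D_def card_image inj_on_def sum.reindex)
  show ?thesis using char_linear_statistic[OF D(1), of c t] unfolding D(2,3) .
qed

text \<open>In the unit disc \<open>N\<close>-th powers differ by at most \<open>N\<close> times the
  difference of their bases, so the one-variable approximation may be raised to the power
  \<open>N\<close>, also when \<open>p\<close> varies with \<open>N\<close>.\<close>

lemma tendsto_centered_bernoulli_char_power:
  fixes p \<theta> :: "nat \<Rightarrow> real"
  assumes p: "\<And>N. 0 \<le> p N \<and> p N \<le> 1"
    and \<theta>: "\<theta> \<longlonglongrightarrow> 0"
    and var: "(\<lambda>N. N * ((\<theta> N)\<^sup>2 * (p N * (1 - p N)))) \<longlonglongrightarrow> s"
  shows "(\<lambda>N. (p N * iexp (\<theta> N * (1 - p N)) + (1 - p N) * iexp (\<theta> N * (0 - p N))) ^ N)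
    \<longlonglongrightarrow> complex_of_real (exp (- s / 2))"
proof -
  define y where "y N = (\<theta> N)\<^sup>2 * (p N * (1 - p N))" for N
  define z where "z N = p N * iexp (\<theta> N * (1 - p N)) + (1 - p N) * iexp (\<theta> N * (0 - p N))" for N
  have y0: "0 \<le> y N" for N using p[of N] by (simp add: y_def)
  have z1: "cmod (z N) \<le> 1" for N
  proof -
    have "cmod (z N) \<le> cmod (p N * iexp (\<theta> N * (1 - p N))) + cmod ((1 - p N) * iexp (\<theta> N * (0 - p N)))"
      unfolding z_def by (rule norm_triangle_ineq)
    also have "\<dots> = p N + (1 - p N)"
      using p[of N] by (simp only: norm_mult norm_exp_i_times norm_of_real) simp
    finally show ?thesis by simp
  qed
  have bound: "cmod (z N ^ N - complex_of_real (exp (- (y N / 2))) ^ N) \<le> N * y N * (\<bar>\<theta> N\<bar> + (\<theta> N)\<^sup>2)" for N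
  proof -
    have "cmod (z N ^ N - complex_of_real (exp (- (y N / 2))) ^ N) \<le> N * cmod (z N - complex_of_real (exp (- (y N / 2))))"
      using z1 y0 by (intro norm_power_diff) auto
    also have "\<dots> \<le> N * (y N * (\<bar>\<theta> N\<bar> + (\<theta> N)\<^sup>2))"
      using centered_bernoulli_char_approx[of "p N" "\<theta> N"] p[of N]
      unfolding z_def y_def by (intro mult_left_mono) auto
    finally show ?thesis by (simp add: mult.assoc)
  qed
  have "(\<lambda>N. N * y N * (\<bar>\<theta> N\<bar> + (\<theta> N)\<^sup>2)) \<longlonglongrightarrow> s * (\<bar>0\<bar> + 0\<^sup>2)"
    using var unfolding y_def by (intro tendsto_intros \<theta>)
  then have diff: "(\<lambda>N. z N ^ N - complex_of_real (exp (- (y N / 2))) ^ N) \<longlonglongrightarrow> 0"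
    by (intro Lim_null_comparison[OF always_eventually[OF allI[OF bound]]]) simp
  have "(\<lambda>N. complex_of_real (exp (- (y N / 2))) ^ N) \<longlonglongrightarrow> complex_of_real (exp (- s / 2))"
  proof -
    have "complex_of_real (exp (- (y N / 2))) ^ N = complex_of_real (exp (- (N * y N) / 2))" for N
      by (simp flip: of_real_power exp_of_nat_mult)
    moreover have "(\<lambda>N. complex_of_real (exp (- (N * y N) / 2))) \<longlonglongrightarrow> complex_of_real (exp (- s / 2))"
      using var unfolding y_def by (intro tendsto_intros) auto
    ultimately show ?thesis by simp
  qed
  from tendsto_add[OF diff this] have "(\<lambda>N. z N ^ N) \<longlonglongrightarrow> complex_of_real (exp (- s / 2))"
    by (simp only: diff_add_cancel add_0)
  then show ?thesis unfolding z_def .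
qed

theorem theorem1p1:
  fixes M :: "nat \<Rightarrow> 'a measure"
    and p :: "nat \<Rightarrow> real"
    and \<epsilon> :: "nat \<Rightarrow> nat \<Rightarrow> nat \<Rightarrow> 'a \<Rightarrow> real"
    and \<beta> :: real
    and Z :: "nat \<Rightarrow> 'a \<Rightarrow> real"
  defines "Z \<equiv> \<lambda>N \<omega>. partition_function N (p N) \<beta> (\<lambda>i j. \<epsilon> N i j \<omega>)"
  assumes prob: "\<And>N. prob_space (M N)"
    and p_range: "\<And>N. 0 < p N \<and> p N \<le> 1"
    and indep: "\<And>N. prob_space.indep_vars (M N) (\<lambda>_. borel)
                  (\<lambda>(i, j). \<epsilon> N i j) ({1..N} \<times> {1..N})"
    and prob_1: "\<And>N i j. i \<in> {1..N} \<Longrightarrow> j \<in> {1..N} \<Longrightarrow>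
                  measure (M N) {\<omega> \<in> space (M N). \<epsilon> N i j \<omega> = 1} = p N"
    and prob_0: "\<And>N i j. i \<in> {1..N} \<Longrightarrow> j \<in> {1..N} \<Longrightarrow>
                  measure (M N) {\<omega> \<in> space (M N). \<epsilon> N i j \<omega> = 0} = 1 - p N"
    and beta: "0 < \<beta>" "\<beta> < 1"
    and p2N: "filterlim (\<lambda>N. (p N)\<^sup>2 * real N) at_top sequentially"
    and qNp: "filterlim (\<lambda>N. (1 - p N) * real N * p N) at_top sequentially"
  shows "weak_conv_m
           (\<lambda>N. distr (M N) borel
              (\<lambda>\<omega>. sqrt (p N * real N / (1 - p N)) *
                    (Z N \<omega> / (\<integral>\<omega>'. Z N \<omega>' \<partial>M N) - 1)))
           (centered_normal (\<beta>\<^sup>2 / 4))"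
proof -
  interpret G: random_graph "M N" N "\<epsilon> N" "p N" for N
  proof (intro random_graph.intro bernoulli_family.intro bernoulli_family_axioms.intro random_graph_axioms.intro)
  qed (use prob indep prob_0 prob_1 p_range in auto)

  define \<gamma> where "\<gamma> N = \<beta> / (2 * real N * p N)" for N
  define a where "a N = edge_slope (p N) (\<gamma> N) 1" for N
  define c where "c N = sqrt (p N * real N / (1 - p N))" for N
  define \<delta> where "\<delta> N = 4 * (p N * (1 - p N)) * real N * (\<gamma> N)\<^sup>2" for N
  define X where "X N \<omega> = c N * (Z N \<omega> / (\<integral>\<omega>'. Z N \<omega>' \<partial>M N) - 1)" for N \<omega>
  define L where "L N \<omega> = (c N * a N) * (\<Sum>i=1..N. \<epsilon> N i i \<omega> - p N)" for N \<omega>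
  define d where "d N = (\<Sum>\<sigma>\<in>spin_configs N. \<Sum>\<tau>\<in>spin_configs N.
      curie_weiss N (edge_coupling (p N) (\<gamma> N)) \<sigma> * curie_weiss N (edge_coupling (p N) (\<gamma> N)) \<tau> *
       (\<Prod>(i, j)\<in>{1..N} \<times> {1..N}. 1 + p N * (1 - p N) *
          (edge_slope (p N) (\<gamma> N) (\<sigma> i * \<sigma> j) * edge_slope (p N) (\<gamma> N) (\<tau> i * \<tau> j))))
      - 1 - real N * (a N)\<^sup>2 * (p N * (1 - p N))" for N
  \<comment> \<open>A fixed level strictly between \<open>\<beta>\<close> and 1: the effective
    inverse temperature stays below it eventually, and \<open>1 - b\<close> does not depend on
    \<open>N\<close>.\<close>
  define b where "b = (1 + \<beta>) / 2"
  have b: "\<beta> < b" "b < 1" using beta by (auto simp: b_def)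
  have p: "0 < p N" "p N \<le> 1" for N using p_range by auto

  have Np: "filterlim (\<lambda>N. real N * p N) at_top sequentially"
  proof (rule filterlim_at_top_mono[OF p2N])
    show "\<forall>\<^sub>F N in sequentially. (p N)\<^sup>2 * real N \<le> real N * p N"
    proof (intro always_eventually allI)
      fix N
      have "p N * p N \<le> p N" using p[of N] by (simp add: mult_left_le)
      then have "p N * p N * real N \<le> p N * real N" by (intro mult_right_mono) auto
      then show "(p N)\<^sup>2 * real N \<le> real N * p N" by (simp add: power2_eq_square mult.commute)
    qed
  qed
  have \<gamma>_lim: "\<gamma> \<longlonglongrightarrow> 0"
  proof -
    have "(\<lambda>N. \<beta> / 2 * inverse (real N * p N)) \<longlonglongrightarrow> \<beta> / 2 * 0"
      by (intro tendsto_mult tendsto_const tendsto_inverse_0_at_top Np)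
    moreover have "(\<lambda>N. \<beta> / 2 * inverse (real N * p N)) = \<gamma>"
      by (simp add: \<gamma>_def fun_eq_iff divide_simps)
    ultimately show ?thesis by (simp only: mult_zero_right)
  qed
  have \<gamma>N_lim: "(\<lambda>N. (\<gamma> N)\<^sup>2 * real N) \<longlonglongrightarrow> 0"
  proof -
    have "(\<lambda>N. \<beta>\<^sup>2 / 4 * inverse ((p N)\<^sup>2 * real N)) \<longlonglongrightarrow> \<beta>\<^sup>2 / 4 * 0"
      by (intro tendsto_mult tendsto_const tendsto_inverse_0_at_top p2N)
    moreover have "\<beta>\<^sup>2 / 4 * inverse ((p N)\<^sup>2 * real N) = (\<gamma> N)\<^sup>2 * real N" for N
      using p(1)[of N] by (cases "N = 0") (simp_all add: \<gamma>_def power2_eq_square divide_simps)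
    ultimately show ?thesis by (simp only: mult_zero_right)
  qed
  have ev_N: "\<forall>\<^sub>F N in sequentially. N \<ge> 2" by (rule eventually_ge_at_top)
  \<comment> \<open>\<open>p N = 1\<close> is allowed for finitely many \<open>N\<close>; there
    \<open>c N\<close> is 0, by the convention for division by 0.\<close>
  have ev_p: "\<forall>\<^sub>F N in sequentially. p N < 1"
    using filterlim_at_top_dense[THEN iffD1, OF qNp, rule_format, of 0]
  proof eventually_elim
    case (elim N)
    then show ?case using p[of N] by (cases "p N = 1") auto
  qed
  have \<gamma>_pos: "0 < \<gamma> N" if "N \<ge> 2" for N using that p[of N] beta by (simp add: \<gamma>_def)
  \<comment> \<open>One-variable limits at 0 from the right can now be composed with
    \<open>\<gamma>\<close>, once \<open>N * p N\<close> is expressed through it.\<close>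
  have \<gamma>_right: "filterlim \<gamma> (at_right 0) sequentially"
    unfolding filterlim_at
  proof
    show "\<forall>\<^sub>F N in sequentially. \<gamma> N \<in> {0<..} \<and> \<gamma> N \<noteq> 0"
      using ev_N by eventually_elim (use \<gamma>_pos in force)
  qed (rule \<gamma>_lim)
  have Np\<gamma>: "real N * p N = \<beta> / 2 / \<gamma> N" if "N \<ge> 2" for N
    using that p[of N] beta by (simp add: \<gamma>_def)
  have \<delta>_eq: "\<delta> N = 2 * \<beta> * (1 - p N) * \<gamma> N" for N
    using p(1)[of N] by (cases "N = 0") (simp_all add: \<delta>_def \<gamma>_def power2_eq_square divide_simps)
  have \<delta>_lim: "\<delta> \<longlonglongrightarrow> 0"
  proof (rule tendsto_sandwich)
    show "\<forall>\<^sub>F N in sequentially. 0 \<le> \<delta> N"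
      using p by (intro always_eventually allI) (auto simp: \<delta>_def less_imp_le)
    show "\<forall>\<^sub>F N in sequentially. \<delta> N \<le> 2 * \<beta> * \<gamma> N"
      using ev_N
    proof eventually_elim
      case (elim N)
      have "2 * \<beta> * \<gamma> N * (1 - p N) \<le> 2 * \<beta> * \<gamma> N * 1"
        using beta \<gamma>_pos[OF elim] p[of N] by (intro mult_left_mono) auto
      then show ?case by (simp add: \<delta>_eq ac_simps)
    qed
    show "(\<lambda>N. 2 * \<beta> * \<gamma> N) \<longlonglongrightarrow> 0"
      using tendsto_mult[OF tendsto_const \<gamma>_lim, of "2 * \<beta>"] by simp
  qed auto

  have ev_coupling: "\<forall>\<^sub>F N in sequentially. 2 * real N * edge_coupling (p N) (\<gamma> N) \<le> b"
  proof -
    have "((\<lambda>x::real. (exp x - exp (- x)) / x * exp x) \<longlongrightarrow> 2) (at_right 0)"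
      by real_asymp
    from tendsto_mult[OF tendsto_const filterlim_compose[OF this \<gamma>_right], of "\<beta> / 2"]
    have "(\<lambda>N. \<beta> / 2 * ((exp (\<gamma> N) - exp (- \<gamma> N)) / \<gamma> N * exp (\<gamma> N))) \<longlonglongrightarrow> \<beta>" by simp
    from order_tendstoD(2)[OF this b(1)] ev_N show ?thesis
    proof eventually_elim
      case (elim N)
      have "2 * real N * edge_coupling (p N) (\<gamma> N) = real N * (2 * edge_coupling (p N) (\<gamma> N))" by simp
      also have "\<dots> \<le> real N * (p N * (exp (\<gamma> N) - exp (- \<gamma> N)) * exp (\<gamma> N))"
        using p[of N] \<gamma>_pos[OF elim(2)] by (intro mult_left_mono edge_coupling_le) auto
      also have "\<dots> = (real N * p N) * ((exp (\<gamma> N) - exp (- \<gamma> N)) * exp (\<gamma> N))" by simp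
      also have "\<dots> = \<beta> / 2 * ((exp (\<gamma> N) - exp (- \<gamma> N)) / \<gamma> N * exp (\<gamma> N))"
        unfolding Np\<gamma>[OF elim(2)] by simp
      finally show ?case using elim(1) by linarith
    qed
  qed

  have a_lim: "(\<lambda>N. a N * (real N * p N)) \<longlonglongrightarrow> \<beta> / 2"
  proof -
    have "((\<lambda>x::real. (exp x - 1) / x) \<longlongrightarrow> 1) (at_right 0)"
      by real_asymp
    note e = filterlim_compose[OF this \<gamma>_right]
    have m: "(\<lambda>N. edge_mean (p N) (\<gamma> N) 1) \<longlonglongrightarrow> 1"
    proof (rule tendsto_sandwich)
      show "\<forall>\<^sub>F N in sequentially. 1 \<le> edge_mean (p N) (\<gamma> N) 1"
        using ev_N by eventually_elim (intro edge_mean_ge less_imp_le[OF p(1)] p(2) less_imp_le[OF \<gamma>_pos])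
      show "\<forall>\<^sub>F N in sequentially. edge_mean (p N) (\<gamma> N) 1 \<le> exp (\<gamma> N)"
        using ev_N
      proof eventually_elim
        case (elim N)
        have "p N * (exp (\<gamma> N) - 1) \<le> exp (\<gamma> N) - 1"
          using p[of N] \<gamma>_pos[OF elim] by (intro mult_left_le_one_le) auto
        then show ?case by (simp add: edge_mean_def)
      qed
      show "(\<lambda>N. exp (\<gamma> N)) \<longlonglongrightarrow> 1" using tendsto_exp[OF \<gamma>_lim] by simp
    qed auto
    have "(\<lambda>N. \<beta> / 2 * ((exp (\<gamma> N) - 1) / \<gamma> N) / edge_mean (p N) (\<gamma> N) 1) \<longlonglongrightarrow> \<beta> / 2 * 1 / 1"
      by (intro tendsto_intros e m) auto
    moreover have "\<forall>\<^sub>F N in sequentially. \<beta> / 2 * ((exp (\<gamma> N) - 1) / \<gamma> N) / edge_mean (p N) (\<gamma> N) 1 = a N * (real N * p N)"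
      using ev_N by eventually_elim (simp add: Np\<gamma> a_def edge_slope_def mult_ac)
    ultimately show ?thesis by (simp add: tendsto_cong)
  qed

  \<comment> \<open>In this form the size \<open>c N * a N\<close> of a rescaled summand is a
    convergent factor over \<open>sqrt ((1 - p) N p)\<close>, hence tends to 0.\<close>
  have c_eq: "c N = (real N * p N) / sqrt ((1 - p N) * real N * p N)" if "p N < 1" for N
  proof -
    have "p N * real N / (1 - p N) = (real N * p N)\<^sup>2 / ((1 - p N) * real N * p N)"
      using that p[of N] by (cases "N = 0") (auto simp: power2_eq_square field_simps)
    then show ?thesis
      using p[of N] unfolding c_def by (simp add: real_sqrt_divide)
  qed

  have meas_Z [measurable]: "Z N \<in> borel_measurable (M N)" for N
    unfolding Z_def by (rule G.measurable_partition_function)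
  have meas_X: "X N \<in> borel_measurable (M N)" for N
    unfolding X_def by measurable
  have meas_L: "L N \<in> borel_measurable (M N)" for N
    unfolding L_def using G.measurable_edge[of _ N]
    by (intro borel_measurable_times borel_measurable_const borel_measurable_sum borel_measurable_diff) auto
  have sq: "has_bochner_integral (M N) (\<lambda>\<omega>. (X N \<omega> - L N \<omega>)\<^sup>2) ((c N)\<^sup>2 * d N)" for N
  proof -
    have "(X N \<omega> - L N \<omega>)\<^sup>2 = (c N)\<^sup>2 * (Z N \<omega> / (\<integral>\<omega>'. Z N \<omega>' \<partial>M N) - 1 - a N * (\<Sum>i=1..N. \<epsilon> N i i \<omega> - p N))\<^sup>2" for \<omega>
      unfolding X_def L_def power_mult_distrib[symmetric] by (simp add: algebra_simps)
    moreover have "has_bochner_integral (M N)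
        (\<lambda>\<omega>. (Z N \<omega> / (\<integral>\<omega>'. Z N \<omega>' \<partial>M N) - 1 - a N * (\<Sum>i=1..N. \<epsilon> N i i \<omega> - p N))\<^sup>2) (d N)"
      using G.partition_function_square_error[of N \<beta>] unfolding Z_def d_def a_def \<gamma>_def by simp
    ultimately show ?thesis by (simp add: has_bochner_integral_mult_right)
  qed

  have err: "(\<lambda>N. (c N)\<^sup>2 * d N) \<longlonglongrightarrow> 0"
  proof (rule tendsto_sandwich)
    define K where "K = 128 / (1 - b)\<^sup>2"
    define r where "r N = (\<gamma> N)\<^sup>2 * real N + 2 * K * \<gamma> N + 2 * \<gamma> N + 2 * K\<^sup>2 / real N
        + 8192 * exp 1 / (1 - b) ^ 3 * \<delta> N" for N
    show "\<forall>\<^sub>F N in sequentially. 0 \<le> (c N)\<^sup>2 * d N"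
    proof (intro always_eventually allI)
      fix N
      have "0 \<le> (\<integral>\<omega>. (X N \<omega> - L N \<omega>)\<^sup>2 \<partial>M N)" by (intro integral_nonneg_AE) simp
      then show "0 \<le> (c N)\<^sup>2 * d N" using sq[of N] by (simp only: has_bochner_integral_iff)
    qed
    have "\<forall>\<^sub>F N in sequentially. \<gamma> N < 1" "\<forall>\<^sub>F N in sequentially. (\<gamma> N)\<^sup>2 * real N < 1"
      "\<forall>\<^sub>F N in sequentially. \<delta> N < (1 - b) / 32"
      by (rule order_tendstoD(2)[OF \<gamma>_lim] order_tendstoD(2)[OF \<gamma>N_lim] order_tendstoD(2)[OF \<delta>_lim]; use b in simp)+
    then show "\<forall>\<^sub>F N in sequentially. (c N)\<^sup>2 * d N \<le> \<beta>\<^sup>2 * r N"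
      using ev_N ev_p ev_coupling
    proof eventually_elim
      case (elim N)
      have "d N \<le> \<delta> N * r N"
        unfolding d_def a_def r_def \<delta>_def K_def
        by (rule second_moment_excess_le) (use elim p[of N] b \<gamma>_pos[of N] in \<open>auto simp: \<delta>_def\<close>)
      then have "(c N)\<^sup>2 * d N \<le> (c N)\<^sup>2 * (\<delta> N * r N)" by (intro mult_left_mono) auto
      also have "\<dots> = ((c N)\<^sup>2 * \<delta> N) * r N" by simp
      \<comment> \<open>The scaling \<open>c\<close> matches \<open>\<delta>\<close> exactly, so
        what remains of the error is the relative term \<open>r\<close>.\<close>
      also have "(c N)\<^sup>2 * \<delta> N = \<beta>\<^sup>2"
        using elim p[of N] by (simp add: c_def \<delta>_eq \<gamma>_def power2_eq_square field_simps)
      finally show ?case .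
    qed
    have "r \<longlonglongrightarrow> 0 + 2 * K * 0 + 2 * 0 + 0 + 8192 * exp 1 / (1 - b) ^ 3 * 0"
      unfolding r_def
      by (intro tendsto_intros \<gamma>N_lim \<gamma>_lim \<delta>_lim tendsto_divide_0[OF tendsto_const]
          filterlim_at_top_imp_at_infinity filterlim_real_sequentially)
    from tendsto_mult[OF tendsto_const this, of "\<beta>\<^sup>2"]
    show "(\<lambda>N. \<beta>\<^sup>2 * r N) \<longlonglongrightarrow> 0" by simp
  qed auto

  have char_L: "(\<lambda>N. char (distr (M N) borel (L N)) t) \<longlonglongrightarrow> char (centered_normal (\<beta>\<^sup>2 / 4)) t" for t
  proof -
    define \<theta> where "\<theta> N = t * (c N * a N)" for N
    have "(\<lambda>N. t * (a N * (real N * p N)) * inverse (sqrt ((1 - p N) * real N * p N))) \<longlonglongrightarrow> t * (\<beta> / 2) * 0"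
      by (intro tendsto_mult tendsto_const a_lim tendsto_inverse_0_at_top
          filterlim_compose[OF sqrt_at_top] qNp)
    moreover have "\<forall>\<^sub>F N in sequentially. t * (a N * (real N * p N)) * inverse (sqrt ((1 - p N) * real N * p N)) = \<theta> N"
      using ev_p by eventually_elim (simp add: \<theta>_def c_eq divide_inverse)
    ultimately have \<theta>: "\<theta> \<longlonglongrightarrow> 0" by (simp add: tendsto_cong)
    have "(\<lambda>N. t\<^sup>2 * (a N * (real N * p N))\<^sup>2) \<longlonglongrightarrow> t\<^sup>2 * (\<beta> / 2)\<^sup>2"
      by (intro tendsto_intros a_lim)
    \<comment> \<open>The factors \<open>1 - p\<close> of scaling and variance cancel; the limit of
      \<open>a N * (N * p N)\<close> is \<open>\<beta> / 2\<close>, whence the variance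
      \<open>\<beta>\<^sup>2 / 4\<close>.\<close>
    moreover have "\<forall>\<^sub>F N in sequentially. t\<^sup>2 * (a N * (real N * p N))\<^sup>2 = real N * ((\<theta> N)\<^sup>2 * (p N * (1 - p N)))"
      using ev_p
    proof eventually_elim
      case (elim N)
      have "(\<theta> N)\<^sup>2 = t\<^sup>2 * (p N * real N / (1 - p N)) * (a N)\<^sup>2"
        using elim p[of N] by (simp add: \<theta>_def c_def power_mult_distrib)
      then have "real N * ((\<theta> N)\<^sup>2 * (p N * (1 - p N))) =
          t\<^sup>2 * (a N)\<^sup>2 * (real N * p N)\<^sup>2 * ((1 - p N) / (1 - p N))"
        by (simp add: power2_eq_square mult_ac)
      then show ?case using elim by (simp add: power_mult_distrib)
    qed
    ultimately have var: "(\<lambda>N. real N * ((\<theta> N)\<^sup>2 * (p N * (1 - p N)))) \<longlonglongrightarrow> t\<^sup>2 * (\<beta> / 2)\<^sup>2"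
      by (simp add: tendsto_cong)
    have "(\<lambda>N. (p N * iexp (\<theta> N * (1 - p N)) + (1 - p N) * iexp (\<theta> N * (0 - p N))) ^ N)
        \<longlonglongrightarrow> complex_of_real (exp (- (t\<^sup>2 * (\<beta> / 2)\<^sup>2) / 2))"
      using p by (intro tendsto_centered_bernoulli_char_power \<theta> var) (auto simp: less_imp_le)
    moreover have "char (distr (M N) borel (L N)) t =
        (p N * iexp (\<theta> N * (1 - p N)) + (1 - p N) * iexp (\<theta> N * (0 - p N))) ^ N" for N
      unfolding L_def \<theta>_def by (rule G.char_diagonal_statistic)
    ultimately show ?thesis
      using beta by (simp add: char_centered_normal power_divide)
  qed

  have "weak_conv_m (\<lambda>N. distr (M N) borel (X N)) (centered_normal (\<beta>\<^sup>2 / 4))"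
  proof (rule levy_continuity)
    show "real_distribution (distr (M N) borel (X N))" for N
      using meas_X by (rule G.real_distribution_distr)
    show "real_distribution (centered_normal (\<beta>\<^sup>2 / 4))"
      using beta by (intro real_distribution_centered_normal) simp
    fix t
    have "(\<lambda>N. \<bar>t\<bar> * sqrt ((c N)\<^sup>2 * d N)) \<longlonglongrightarrow> \<bar>t\<bar> * sqrt 0"
      by (intro tendsto_intros err)
    then have "(\<lambda>N. char (distr (M N) borel (X N)) t - char (distr (M N) borel (L N)) t) \<longlonglongrightarrow> 0"
      by (intro Lim_null_comparison[OF always_eventually[OF allI[OF G.char_diff_le[OF meas_X meas_L sq]]]]) simp
    from tendsto_add[OF this char_L[of t]]
    show "(\<lambda>N. char (distr (M N) borel (X N)) t) \<longlonglongrightarrow> char (centered_normal (\<beta>\<^sup>2 / 4)) t"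
      by simp
  qed
  then show ?thesis unfolding X_def c_def .
qed

end
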